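(* For every fixed graph $H$ there exists a constant $0<c_H<1$ such that if $e\ge c_H\binom{n}{2}$, then among graphs with $n$ vertices and $e$ edges the number of subgraphs isomorphic to $H$ is asymptotically maximized by the quasi-clique, i.e. $$ex(n,e,H)=(1+o(1))\,N(H,K^e_n)\qquad (n\to\infty).$$
   Context: For graphs $H,G$, $N(H,G)$ denotes the number of (not necessarily induced) subgraphs of $G$ isomorphic to $H$. $ex(n,e,H)=\max\{N(H,G): |V(G)|=n,\ |E(G)|=e\}$. For $0\le e\le\binom n2$ write $e=\binom{a}{2}+b$ with $0\le b<a$; the quasi-clique $K^e_n$ is the $n$-vertex graph consisting of a clique on $a$ vertices, one further vertex joined to exactly $b$ vertices of this clique, and $n-a-1$ isolated vertices (so it has $e$ edges). *)

theory Defs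
  imports Complex_Main "HOL-Library.Ramsey"
begin

(* A graph is a pair (vertex set, edge set); edges are two-element sets of vertices. *)
type_synonym 'a graph = "'a set \<times> 'a set set"

definition verts :: "'a graph \<Rightarrow> 'a set" where
  "verts G = fst G"

definition edges :: "'a graph \<Rightarrow> 'a set set" where
  "edges G = snd G"

definition is_graph :: "'a graph \<Rightarrow> bool" where
  "is_graph G \<longleftrightarrow> finite (verts G) \<and> edges G \<subseteq> nsets (verts G) 2"

definition subgraph_of :: "'a graph \<Rightarrow> 'a graph \<Rightarrow> bool" where
  "subgraph_of S G \<longleftrightarrow> is_graph S \<and> verts S \<subseteq> verts G \<and> edges S \<subseteq> edges G"

definition graph_iso :: "'a graph \<Rightarrow> 'b graph \<Rightarrow> bool" where
  "graph_iso H S \<longleftrightarrow>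
     (\<exists>f. bij_betw f (verts H) (verts S) \<and>
          (\<forall>u\<in>verts H. \<forall>v\<in>verts H. {u, v} \<in> edges H \<longleftrightarrow> {f u, f v} \<in> edges S))"

(* Subgraphs are counted as pairs (vertex set, edge set), so for H with isolated vertices the
   position of these vertices matters. *)
definition num_copies :: "'a graph \<Rightarrow> 'b graph \<Rightarrow> nat" where
  "num_copies H G = card {S. subgraph_of S G \<and> graph_iso H S}"

(* Using nat as vertex type is no restriction, since num_copies is invariant under isomorphism.
   The maximum is over a nonempty set only if e \<le> n choose 2. *)
definition ex_copies :: "nat \<Rightarrow> nat \<Rightarrow> 'a graph \<Rightarrow> nat" where
  "ex_copies n e H =
     Max {num_copies H G | G :: nat graph.
            is_graph G \<and> card (verts G) = n \<and> card (edges G) = e}"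

definition quasi_clique_params :: "nat \<Rightarrow> nat \<times> nat" where
  "quasi_clique_params e = (THE (a, b). e = (a choose 2) + b \<and> b < a)"

(* The clique is {..<a} and the further vertex is a. If e = n choose 2, then a = n and b = 0:
   there is no room for a further vertex, and the graph is the complete graph on n vertices. *)
definition quasi_clique :: "nat \<Rightarrow> nat \<Rightarrow> nat graph" where
  "quasi_clique n e =
     (case quasi_clique_params e of (a, b) \<Rightarrow>
        ({..<n}, nsets {..<a} 2 \<union> {{i, a} | i. i < b}))"

lemma choose_two_Suc: "Suc a choose 2 = (a choose 2) + a"
  by (simp add: numeral_2_eq_2)

lemma quasi_clique_params_exist: "\<exists>a b. e = (a choose 2) + b \<and> b < a"
proof (induction e)
  case 0
  show ?case by (rule exI[of _ 1], rule exI[of _ 0]) (simp add: numeral_2_eq_2)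
next
  case (Suc e)
  then obtain a b where ab: "e = (a choose 2) + b" "b < a" by blast
  show ?case
  proof (cases "Suc b < a")
    case True
    then show ?thesis using ab by (intro exI[of _ a] exI[of _ "Suc b"]) simp
  next
    case False
    then show ?thesis using ab
      by (intro exI[of _ "Suc a"] exI[of _ 0]) (simp add: choose_two_Suc)
  qed
qed

lemma quasi_clique_params_mono:
  assumes "(a choose 2) + b = (a' choose 2) + b'" "b < a" "b' < a'"
  shows "a \<le> a'"
proof (rule ccontr)
  assume "\<not> a \<le> a'"
  then have "Suc a' choose 2 \<le> a choose 2" by (intro binomial_right_mono) auto
  then show False using assms by (simp add: choose_two_Suc)
qed

lemma quasi_clique_params_eqI:
  assumes "e = (a choose 2) + b" "b < a"
  shows "quasi_clique_params e = (a, b)"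
  unfolding quasi_clique_params_def
proof (rule the_equality)
  fix p :: "nat \<times> nat"
  assume p: "case p of (a, b) \<Rightarrow> e = (a choose 2) + b \<and> b < a"
  obtain a' b' where [simp]: "p = (a', b')" by fastforce
  have "a = a'"
    using quasi_clique_params_mono[of a b a' b'] quasi_clique_params_mono[of a' b' a b] p assms
    by (intro antisym) auto
  then show "p = (a, b)" using p assms by simp
qed (use assms in simp)

lemma quasi_clique_graph:
  assumes "e \<le> n choose 2"
  shows "is_graph (quasi_clique n e) \<and> card (verts (quasi_clique n e)) = n \<and>
         card (edges (quasi_clique n e)) = e"
proof -
  obtain a b where ab: "e = (a choose 2) + b" "b < a"
    using quasi_clique_params_exist by blast
  have le: "a \<le> n \<or> n = 0 \<and> a = 1"
  proof (rule ccontr)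
    assume *: "\<not> ?thesis"
    then have "Suc n choose 2 \<le> a choose 2" by (intro binomial_right_mono) auto
    then have "n = 0" using ab assms by (simp add: choose_two_Suc)
    then have "2 \<le> a" using * by linarith
    then have "0 < a choose 2" by (rule zero_less_binomial)
    then show False using \<open>n = 0\<close> ab assms by (simp add: binomial_eq_0)
  qed
  have an: "a < n" if "b > 0"
  proof (rule ccontr)
    assume "\<not> a < n"
    then have "n choose 2 \<le> a choose 2" by (intro binomial_right_mono) auto
    then show False using that ab assms by simp
  qed
  have sub: "nsets {..<a} 2 \<subseteq> nsets {..<n} 2"
    using le
  proof
    assume "a \<le> n"
    then show ?thesis by (intro nsets_mono) auto
  next
    assume *: "n = 0 \<and> a = 1"
    have "nsets {..<a} 2 = {}" using * by (intro nsets_eq_empty) auto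
    then show ?thesis by simp
  qed
  have star: "{{i, a} | i. i < b} = (\<lambda>i. {i, a}) ` {..<b}" by auto
  have inj: "inj_on (\<lambda>i. {i, a}) {..<b}"
    using ab by (auto simp: inj_on_def doubleton_eq_iff)
  have disj: "nsets {..<a} 2 \<inter> (\<lambda>i. {i, a}) ` {..<b} = {}"
    by (auto simp: nsets_def)
  have "card (nsets {..<a} 2 \<union> (\<lambda>i. {i, a}) ` {..<b}) =
        card (nsets {..<a} 2) + card ((\<lambda>i. {i, a}) ` {..<b})"
    by (rule card_Un_disjoint[OF _ _ disj]) (simp_all add: finite_imp_finite_nsets)
  also have "\<dots> = e"
    by (simp only: card_image[OF inj] ab(1) binomial_eq_nsets atLeast0LessThan card_lessThan)
  finally have "card (nsets {..<a} 2 \<union> (\<lambda>i. {i, a}) ` {..<b}) = e" .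
  moreover have "(\<lambda>i. {i, a}) ` {..<b} \<subseteq> nsets {..<n} 2"
  proof
    fix x assume "x \<in> (\<lambda>i. {i, a}) ` {..<b}"
    then obtain i where "i < b" "x = {i, a}" by auto
    then show "x \<in> nsets {..<n} 2" using an ab by simp
  qed
  ultimately show ?thesis
    using sub quasi_clique_params_eqI[OF ab]
    by (simp add: quasi_clique_def is_graph_def verts_def edges_def star)
qed

lemma num_copies_le:
  assumes "is_graph G"
  shows "num_copies H G \<le> 2 ^ card (verts G) * 2 ^ card (edges G)"
proof -
  have fin: "finite (verts G)" "finite (edges G)"
    using assms finite_imp_finite_nsets finite_subset unfolding is_graph_def by blast+
  have "{S. subgraph_of S G \<and> graph_iso H S} \<subseteq> Pow (verts G) \<times> Pow (edges G)"
    by (auto simp: subgraph_of_def verts_def edges_def)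
  then have "num_copies H G \<le> card (Pow (verts G) \<times> Pow (edges G))"
    unfolding num_copies_def using fin by (intro card_mono) auto
  then show ?thesis using fin by (simp add: card_cartesian_product card_Pow)
qed

lemma ex_copies_attained:
  assumes "e \<le> n choose 2"
  shows "finite {num_copies H G | G :: nat graph.
           is_graph G \<and> card (verts G) = n \<and> card (edges G) = e}" (is "finite ?A")
    and "{num_copies H G | G :: nat graph.
           is_graph G \<and> card (verts G) = n \<and> card (edges G) = e} \<noteq> {}"
proof -
  have "?A \<subseteq> {..2 ^ n * 2 ^ e}" using num_copies_le[of _ H] by auto
  then show "finite ?A" by (rule finite_subset) simp
  show "?A \<noteq> {}" using quasi_clique_graph[OF assms] by blast
qed

end

theory Submission
  imports Defs
begin

text \<open>
  Injective homomorphisms from \<open>H\<close> number \<open>|Aut H|\<close> times the copies of \<open>H\<close>. Deleting edges of \<open>H\<close>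
  only creates more homomorphisms, and every graph without isolated vertices has a spanning forest
  of stars. So it suffices to show that for stars the clique is optimal at edge density near 1:
  with \<open>2e\<close> written as \<open>s\<^sup>2\<close>, the sum of the \<open>r\<close>-th powers of the degrees is at most \<open>s\<^bsup>r+1\<^esup>\<close>.

  For this, let \<open>A\<close> consist of the vertices of degree at least \<open>n/2\<close>, and compare with the clique
  on \<open>A\<close>. An edge leaving \<open>A\<close> gains at most about \<open>r + 1/2\<close> in the power sum and contributes
  \<open>r + 1\<close> to the right-hand side, an edge outside \<open>A\<close> gains at most \<open>1\<close> against \<open>r + 1\<close>, and a missing
  edge inside \<open>A\<close> costs more than the \<open>r + 1\<close> by which it lowers the right-hand side: only few
  vertices miss many edges in \<open>A\<close>, hence nearly every missing edge has an end whose loss is close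
  to \<open>r\<close>, and the loss at the other end is at least about \<open>3/2\<close>.
\<close>

section \<open>Degree powers of dense symmetric kernels\<close>

lemma power_diff_le:
  fixes a c :: real
  assumes "0 \<le> c" "c \<le> a"
  shows "a ^ k - c ^ k \<le> real k * (a - c) * a ^ (k - 1)"
proof (induction k)
  case (Suc k)
  have "a ^ Suc k - c ^ Suc k = a * (a ^ k - c ^ k) + (a - c) * c ^ k"
    by (simp add: algebra_simps)
  also have "\<dots> \<le> a * (real k * (a - c) * a ^ (k - 1)) + (a - c) * a ^ k"
    using assms Suc.IH by (intro add_mono mult_left_mono power_mono) auto
  also have "\<dots> = real (Suc k) * (a - c) * a ^ (Suc k - 1)"
    by (cases k) (simp_all add: algebra_simps)
  finally show ?case .
qed simp

lemma power_diff_ge: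
  fixes a c :: real
  assumes "0 \<le> c" "c \<le> a"
  shows "real k * (a - c) * c ^ (k - 1) \<le> a ^ k - c ^ k"
proof (induction k)
  case (Suc k)
  have "real (Suc k) * (a - c) * c ^ (Suc k - 1)
      = c * (real k * (a - c) * c ^ (k - 1)) + (a - c) * c ^ k"
    by (cases k) (simp_all add: algebra_simps)
  also have "\<dots> \<le> c * (a ^ k - c ^ k) + (a - c) * a ^ k"
    using assms Suc.IH by (intro add_mono mult_left_mono power_mono) auto
  also have "\<dots> = a ^ Suc k - c ^ Suc k" by (simp add: algebra_simps)
  finally show ?case .
qed simp

text \<open>The tangent line of \<open>u \<mapsto> u\<^bsup>k/2\<^esup>\<close> at \<open>u = a\<^sup>2\<close>, evaluated at \<open>u = s\<^sup>2\<close>.\<close>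

lemma half_power_tangent:
  fixes s a :: real
  assumes "0 \<le> s" "0 \<le> a"
  shows "2 * a ^ (k + 2) + real (k + 2) * a ^ k * (s\<^sup>2 - a\<^sup>2) \<le> 2 * s ^ (k + 2)"
proof (induction k rule: less_induct)
  case (less k)
  \<comment> \<open>The exponent \<open>(k + 2) / 2\<close> is at least 1, so the function is
    convex. The induction runs in steps of two, since raising this exponent by one multiplies the
    function by \<open>s^2\<close>.\<close>
  consider "k = 0" | "k = 1" | l where "k = l + 2"
    by (metis One_nat_def Suc_1 add.commute add_2_eq_Suc not0_implies_Suc)
  then show ?case
  proof cases
    case 1
    then show ?thesis by (simp add: power2_eq_square)
  next
    case 2
    have "0 \<le> (s - a)\<^sup>2 * (2 * s + a)" using assms by simp
    then show ?thesis using 2 by (simp add: algebra_simps power2_eq_square eval_nat_numeral)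
  next
    case 3
    have IH: "2 * a ^ (l + 2) + real (l + 2) * a ^ l * (s\<^sup>2 - a\<^sup>2) \<le> 2 * s ^ (l + 2)"
      using less.IH[of l] 3 by simp
    \<comment> \<open>The tangent line for \<open>l\<close>, multiplied by \<open>s^2\<close>,
      exceeds the one for \<open>l + 2\<close> by a nonnegative multiple of a square.\<close>
    have "2 * a ^ (k + 2) + real (k + 2) * a ^ k * (s\<^sup>2 - a\<^sup>2)
        = s\<^sup>2 * (2 * a ^ (l + 2) + real (l + 2) * a ^ l * (s\<^sup>2 - a\<^sup>2))
          - real (l + 2) * a ^ l * (s\<^sup>2 - a\<^sup>2)\<^sup>2"
      unfolding 3 by (simp add: algebra_simps power2_eq_square)
    also have "\<dots> \<le> s\<^sup>2 * (2 * a ^ (l + 2) + real (l + 2) * a ^ l * (s\<^sup>2 - a\<^sup>2))"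
      using assms by simp
    also have "\<dots> \<le> s\<^sup>2 * (2 * s ^ (l + 2))"
      using IH by (intro mult_left_mono) auto
    also have "\<dots> = 2 * s ^ (k + 2)" unfolding 3 by (simp add: power_add power2_eq_square)
    finally show ?thesis .
  qed
qed

section \<open>Constants and the estimate at a single vertex\<close>

text \<open>Threshold for the missing degree of a vertex inside \<open>A\<close>, divided by the
  order. Below it the loss per missing pair is nearly \<open>r\<close>, because
  \<open>r * (1 - 2 * r * star_eta r) = r - 1/16\<close>.\<close>

definition star_eta :: "nat \<Rightarrow> real" where
  "star_eta r = 1 / (32 * (real r)\<^sup>2)"

text \<open>Allowed deficit of the density from 1. It is quadratic in \<open>star_eta r\<close> so
  that the share of vertices above the threshold has square at most \<open>1 / (8 * r)\<close> times
  the density of missing pairs.\<close>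

definition star_delta :: "nat \<Rightarrow> real" where
  "star_delta r = (star_eta r)\<^sup>2 / (8 * real r)"

lemma star_constants:
  assumes "2 \<le> r"
  shows "0 < star_eta r" "0 < star_delta r" "2 * star_delta r \<le> star_eta r"
    "real r * real r * star_eta r = 1 / 32" "real r * star_eta r \<le> 1 / 64"
    "star_eta r \<le> 1 / 128"
proof -
  show eta: "0 < star_eta r" and "0 < star_delta r"
    using assms by (auto simp: star_eta_def star_delta_def)
  show sq: "real r * real r * star_eta r = 1 / 32"
    using assms by (simp add: star_eta_def power2_eq_square)
  have "2 * (real r * star_eta r) \<le> real r * (real r * star_eta r)"
    using assms eta by (intro mult_right_mono) auto
  then show re: "real r * star_eta r \<le> 1 / 64" using sq by (simp add: mult.assoc)
  have "2 * star_eta r \<le> real r * star_eta r" using assms eta by (intro mult_right_mono) auto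
  then show e: "star_eta r \<le> 1 / 128" using re by linarith
  have "2 * star_delta r = star_eta r * (star_eta r / (4 * real r))"
    by (simp add: star_delta_def power2_eq_square)
  also have "\<dots> \<le> star_eta r * 1"
    using eta e assms by (intro mult_left_mono) auto
  finally show "2 * star_delta r \<le> star_eta r" by simp
qed

text \<open>Bernoulli's inequality. By \<open>star_constants\<close> the error
  \<open>real r * (2 * star_eta r)\<close> is at most 1/32.\<close>

lemma star_power_lower:
  assumes r: "2 \<le> r" and a: "1 - 2 * star_eta r \<le> a" "a \<le> 1" and k: "k \<le> r"
  shows "1 - real r * (2 * star_eta r) \<le> a ^ k"
proof -
  note c = star_constants[OF r]
  have "1 - real r * (2 * star_eta r) \<le> 1 - real k * (2 * star_eta r)"
    using k c by (intro diff_left_mono mult_right_mono) auto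
  also have "\<dots> \<le> (1 - 2 * star_eta r) ^ k"
    using Bernoulli_inequality[of "- (2 * star_eta r)" k] c by simp
  also have "\<dots> \<le> a ^ k" using a c by (intro power_mono) auto
  finally show ?thesis .
qed

text \<open>For a vertex of the large-degree set \<open>A\<close>, divided by the order:
  \<open>a\<close> is the size of \<open>A\<close>, \<open>m\<close> the missing degree inside
  \<open>A\<close>, \<open>b\<close> the degree outside. Adding \<open>b\<close> gains at most slope
  \<open>r\<close> because degrees stay below 1. Losing \<open>m\<close> costs slope close to
  \<open>r\<close> while the base stays near 1, and close to 3/2 as long as
  \<open>m \<le> 1/2\<close>.\<close>

lemma star_vertex_bound:
  fixes a b m :: real
  assumes r: "2 \<le> r" and b: "0 \<le> b" "a + b \<le> 1" and m: "0 \<le> m"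
    and x: "1 / 2 \<le> a - m + b" and a: "1 - 2 * star_delta r \<le> a"
  shows "(a - m + b) ^ r \<le> a ^ r + real r * b - (3 / 2 - 1 / 8) * m"
    and "m \<le> star_eta r \<Longrightarrow> (a - m + b) ^ r \<le> a ^ r + real r * b - (real r - 1 / 8) * m"
proof -
  note c = star_constants[OF r]
  have a1: "a \<le> 1" using b by linarith
  have m2: "m \<le> 1 / 2" using x b by linarith
  have am: "0 \<le> a - m" using m2 a c by linarith
  have a_eta: "1 - 2 * star_eta r \<le> a" using a c by linarith
  have re: "real r * (2 * star_eta r) \<le> 1 / 32" using c(5) by linarith
  have "(a - m + b) ^ r - (a - m) ^ r \<le> real r * b * (a - m + b) ^ (r - 1)"
    using power_diff_le[of "a - m" "a - m + b" r] am b by simp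
  also have "\<dots> \<le> real r * b * 1"
    using am b m by (intro mult_left_mono power_le_one) auto
  finally have 1: "(a - m + b) ^ r \<le> (a - m) ^ r + real r * b" by simp
  \<comment> \<open>Only two factors carry the loss; as \<open>a - m\<close> may be close to 1/2,
    the other \<open>r - 2\<close> are merely bounded by \<open>a\<close>.\<close>
  have "(a - m) ^ r = (a - m) ^ (r - 2) * (a - m)\<^sup>2"
    using r by (metis le_add_diff_inverse2 power_add)
  also have "\<dots> \<le> a ^ (r - 2) * (a - m)\<^sup>2"
    using am m by (intro mult_right_mono power_mono) auto
  also have "\<dots> = a ^ (r - 2) * a\<^sup>2 - a ^ (r - 2) * (m * (2 * a - m))"
    by (simp add: power2_eq_square algebra_simps)
  also have "a ^ (r - 2) * a\<^sup>2 = a ^ r"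
    using r by (metis le_add_diff_inverse2 power_add)
  finally have 2: "(a - m) ^ r \<le> a ^ r - a ^ (r - 2) * (m * (2 * a - m))" .
  \<comment> \<open>The factors bound \<open>a ^ (r - 2)\<close> and \<open>2 * a - m\<close> from
    below, the latter by \<open>a \<ge> 1 - 1/64\<close> and \<open>m \<le> 1/2\<close>.\<close>
  have "3 / 2 - 1 / 8 \<le> (1 - 1 / 32) * (3 / 2 - 1 / 32 :: real)" by simp
  also have "\<dots> \<le> a ^ (r - 2) * (2 * a - m)"
    using star_power_lower[OF r a_eta a1, of "r - 2"] re a_eta m2 c(6)
    by (intro mult_mono) auto
  finally have "(3 / 2 - 1 / 8) * m \<le> a ^ (r - 2) * (2 * a - m) * m"
    using m by (intro mult_right_mono) auto
  then show "(a - m + b) ^ r \<le> a ^ r + real r * b - (3 / 2 - 1 / 8) * m"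
    using 1 2 by (simp add: mult_ac)
  assume me: "m \<le> star_eta r"
  have am2: "1 - 2 * star_eta r \<le> a - m" using me a c by linarith
  have "real r - 1 / 8 \<le> real r * (1 - real r * (2 * star_eta r))"
    using c(4) by (simp add: algebra_simps)
  also have "\<dots> \<le> real r * (a - m) ^ (r - 1)"
    using star_power_lower[OF r am2, of "r - 1"] a1 m by (intro mult_left_mono) auto
  finally have "(real r - 1 / 8) * m \<le> real r * (a - m) ^ (r - 1) * m"
    using m by (intro mult_right_mono) auto
  also have "\<dots> \<le> a ^ r - (a - m) ^ r"
    using power_diff_ge[of "a - m" a r] am m by (simp add: mult_ac)
  finally show "(a - m + b) ^ r \<le> a ^ r + real r * b - (real r - 1 / 8) * m"
    using 1 by linarith
qed

text \<open>Densities of ordered pairs: \<open>p\<close> from \<open>A\<close> to its complement,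
  \<open>q\<close> inside the complement, \<open>p'\<close> missing inside \<open>A\<close>,
  \<open>X\<close> the part of \<open>p'\<close> starting at vertices above the threshold. The
  tangent at \<open>a^2\<close> makes the right-hand side linear in \<open>p\<close>,
  \<open>q\<close>, \<open>p'\<close>, and the coefficients are compared one by one.\<close>

lemma star_balance:
  fixes a p q p' s X :: real
  assumes r: "2 \<le> r" and a: "1 - 2 * star_delta r \<le> a" "a \<le> 1"
    and nonneg: "0 \<le> p" "0 \<le> q" "0 \<le> p'" "0 \<le> s"
    and s: "s\<^sup>2 = a\<^sup>2 - p' + 2 * p + q"
    and X: "X \<le> p' / 2 * (1 + 1 / (8 * real r))"
  shows "a * a ^ r + real r * p - (real r - 1 / 8) * (p' - X) - (3 / 2 - 1 / 8) * X + (p + q) / 2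
           \<le> s ^ (r + 1)"
proof -
  note c = star_constants[OF r]
  have a0: "0 \<le> a" using a c by linarith
  have a_eta: "1 - 2 * star_eta r \<le> a" using a c by linarith
  have re: "real r * (2 * star_eta r) \<le> 1 / 32" using c(5) by linarith
  \<comment> \<open>The slope of the tangent is \<open>(r + 1) / 2 * t\<close>.\<close>
  define t where "t = a ^ (r - 1)"
  have t1: "t \<le> 1" using a a0 by (simp add: t_def power_le_one)
  have t2: "1 - real r * (2 * star_eta r) \<le> t"
    using star_power_lower[OF r a_eta a(2)] by (simp add: t_def)
  have "(real r + 1) * (1 - real r * (2 * star_eta r)) \<le> (real r + 1) * t"
    using t2 by (intro mult_left_mono) auto
  moreover have "(real r + 1) * (1 - real r * (2 * star_eta r))
      = real r + 1 - 2 * (real r * real r * star_eta r) - real r * (2 * star_eta r)"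
    by (simp add: algebra_simps)
  ultimately have t4: "real r + 1 / 2 \<le> (real r + 1) * t" using c(4) re by linarith
  have t5: "1 \<le> (real r + 1) * t"
    using t4 r by linarith
  have "2 * a ^ ((r - 1) + 2) + real ((r - 1) + 2) * a ^ (r - 1) * (s\<^sup>2 - a\<^sup>2) \<le> 2 * s ^ ((r - 1) + 2)"
    using nonneg a0 by (intro half_power_tangent)
  moreover have "(r - 1) + 2 = r + 1" using r by simp
  ultimately have tan: "2 * (a * a ^ r) + (real r + 1) * t * (2 * p + q - p') \<le> 2 * s ^ (r + 1)"
    by (simp add: t_def s add.commute add_diff_eq)
  have "(real r + 1 / 2) * p \<le> (real r + 1) * t * p"
    using t4 nonneg by (intro mult_right_mono)
  then have P: "real r * p + p / 2 \<le> (real r + 1) * t * p" by (simp add: distrib_right)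
  have Q: "1 * q \<le> (real r + 1) * t * q"
    using t5 nonneg by (intro mult_right_mono)
  have "(real r + 1) * t * p' \<le> (real r + 1) * 1 * p'"
    using t1 nonneg by (intro mult_right_mono mult_left_mono) auto
  then have P': "(real r + 1) * t * p' \<le> real r * p' + p'" by (simp add: distrib_right)
  \<comment> \<open>With \<open>X\<close> equal to half of \<open>p'\<close>, the mean loss
    \<open>(r + 3/2) / 2\<close> exceeds the required \<open>(r + 1) / 2\<close> by 1/4. This margin
    covers the tolerance 1/8 in both slopes and the excess of \<open>X\<close>, which costs at most
    1/16.\<close>
  have "(real r - 3 / 2) * X \<le> (real r - 3 / 2) * (p' / 2 * (1 + 1 / (8 * real r)))"
    using X r by (intro mult_left_mono) auto
  also have "\<dots> = (real r - 3 / 2) * p' / 2 + (real r - 3 / 2) / (16 * real r) * p'"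
    by (simp add: distrib_left)
  also have "(real r - 3 / 2) / (16 * real r) * p' \<le> 1 / 16 * p'"
    using r nonneg by (intro mult_right_mono) (auto simp: divide_le_eq)
  finally have X': "(real r - 3 / 2) * X \<le> (real r - 3 / 2) * p' / 2 + 1 / 16 * p'" by simp
  have half: "(real r - 3 / 2) * p' / 2 = real r * p' / 2 - 3 / 4 * p'"
    by (simp add: left_diff_distrib diff_divide_distrib)
  define L where "L = (real r - 1 / 8) * (p' - X) + (3 / 2 - 1 / 8) * X"
  have "L = real r * p' - 1 / 8 * p' - (real r - 3 / 2) * X"
    by (simp add: L_def left_diff_distrib right_diff_distrib)
  then have L: "real r * p' / 2 + p' / 2 \<le> L" using X' half nonneg by linarith
  have "(real r + 1) * t * (2 * p + q - p')
      = 2 * ((real r + 1) * t * p) + (real r + 1) * t * q - (real r + 1) * t * p'"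
    by (simp add: distrib_left right_diff_distrib)
  then have "a * a ^ r + real r * p - L + (p + q) / 2 \<le> s ^ (r + 1)"
    using tan P Q P' L by argo
  then show ?thesis unfolding L_def by argo
qed

section \<open>The power sum inequality for kernels\<close>

lemma kernel_star_bound_ge_2:
  fixes W :: "'v \<Rightarrow> 'v \<Rightarrow> real"
  assumes V: "finite V" "V \<noteq> {}" and r: "2 \<le> r"
    and sym: "\<And>v w. v \<in> V \<Longrightarrow> w \<in> V \<Longrightarrow> W v w = W w v"
    and W0: "\<And>v w. v \<in> V \<Longrightarrow> w \<in> V \<Longrightarrow> 0 \<le> W v w"
    and W1: "\<And>v w. v \<in> V \<Longrightarrow> w \<in> V \<Longrightarrow> W v w \<le> 1"
    and dense: "(1 - star_delta r) * (real (card V))\<^sup>2 \<le> (\<Sum>v\<in>V. \<Sum>w\<in>V. W v w)"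
  shows "(\<Sum>v\<in>V. (\<Sum>w\<in>V. W v w) ^ r) \<le> sqrt (\<Sum>v\<in>V. \<Sum>w\<in>V. W v w) ^ (r + 1)"
proof -
  note c = star_constants[OF r]
  define n where "n = real (card V)"
  have n: "0 < n" using V by (simp add: n_def card_gt_0_iff)
  define x where "x v = (\<Sum>w\<in>V. W v w) / n" for v
  define A where "A = {v \<in> V. 1 / 2 \<le> x v}"
  define B where "B = {v \<in> V. x v < 1 / 2}"
  have AB: "V = A \<union> B" "A \<inter> B = {}" "finite A" "finite B" "A \<subseteq> V" "B \<subseteq> V"
    using V by (auto simp: A_def B_def)
  have split: "sum f V = sum f A + sum f B" for f :: "'v \<Rightarrow> real"
    using AB by (simp add: sum.union_disjoint)
  define a where "a = card A / n"
  define \<beta> where "\<beta> = card B / n"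
  have a\<beta>: "a + \<beta> = 1" "0 \<le> a" "0 \<le> \<beta>"
    using split[of "\<lambda>_. 1"] n by (simp_all add: a_def \<beta>_def n_def add_divide_distrib[symmetric])
  define m where "m v = (\<Sum>w\<in>A. 1 - W v w) / n" for v
  define b where "b v = (\<Sum>w\<in>B. W v w) / n" for v
  have x_eq: "x v = a - m v + b v" for v
    using n by (simp add: x_def m_def b_def a_def split sum_subtractf field_simps)
  have x1: "x v \<le> 1" if "v \<in> V" for v
    using sum_bounded_above[of V "W v" 1] that W1 n by (simp add: x_def n_def)
  have x0: "0 \<le> x v" if "v \<in> V" for v
    using that W0 n by (auto simp: x_def intro!: divide_nonneg_pos sum_nonneg)
  have m0: "0 \<le> m v" if "v \<in> V" for v
    using that W1 n AB by (auto simp: m_def intro!: divide_nonneg_pos sum_nonneg)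
  have b0: "0 \<le> b v" if "v \<in> V" for v
    using that W0 n AB by (auto simp: b_def intro!: divide_nonneg_pos sum_nonneg)
  have b\<beta>: "b v \<le> \<beta>" if "v \<in> V" for v
    unfolding b_def \<beta>_def using that W1 n AB sum_bounded_above[of B "W v" 1]
    by (intro divide_right_mono) auto
  define d where "d = (\<Sum>v\<in>V. \<Sum>w\<in>V. W v w) / n\<^sup>2"
  have d_x: "d = (\<Sum>v\<in>V. x v) / n"
    by (simp add: d_def x_def sum_divide_distrib power2_eq_square)
  have d0: "0 \<le> d" unfolding d_x using x0 n by (auto intro!: divide_nonneg_pos sum_nonneg)
  have d: "1 - d \<le> star_delta r"
    using dense n by (simp add: d_def n_def[symmetric] field_simps)
  have dx: "1 - d = (\<Sum>v\<in>V. 1 - x v) / n"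
    using n by (simp add: d_x sum_subtractf n_def diff_divide_distrib)
  \<comment> \<open>A vertex of \<open>B\<close> misses at least half of the order, so the share of
    \<open>B\<close> is at most twice the deficit \<open>1 - d\<close>.\<close>
  have "\<beta> / 2 = (\<Sum>v\<in>B. 1 / 2) / n" by (simp add: \<beta>_def)
  also have "\<dots> \<le> (\<Sum>v\<in>B. 1 - x v) / n"
    using n by (intro divide_right_mono sum_mono) (auto simp: B_def)
  also have "\<dots> \<le> (\<Sum>v\<in>V. 1 - x v) / n"
    using n x1 AB V by (intro divide_right_mono sum_mono2) auto
  finally have a_ge: "1 - 2 * star_delta r \<le> a" using d dx a\<beta> by linarith
  define p where "p = (\<Sum>v\<in>A. b v) / n"
  define q where "q = (\<Sum>v\<in>B. b v) / n"
  define p' where "p' = (\<Sum>v\<in>A. m v) / n"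
  have nonneg: "0 \<le> p" "0 \<le> q" "0 \<le> p'"
    using b0 m0 AB n by (auto simp: p_def q_def p'_def intro!: divide_nonneg_pos sum_nonneg)
  \<comment> \<open>By symmetry the pairs from \<open>B\<close> to \<open>A\<close> have density
    \<open>p\<close> too, which is why \<open>2 * p\<close> appears in \<open>d\<close>.\<close>
  have "(\<Sum>v\<in>B. \<Sum>w\<in>A. W v w) = (\<Sum>v\<in>A. \<Sum>w\<in>B. W v w)"
    by (subst sum.swap) (use sym AB in \<open>auto intro!: sum.cong\<close>)
  then have BA: "(\<Sum>v\<in>B. (\<Sum>w\<in>A. W v w) / n) = n * p"
    using n by (simp add: p_def b_def sum_divide_distrib[symmetric])
  have xB: "(\<Sum>v\<in>B. x v) = n * (p + q)"
  proof -
    have "(\<Sum>v\<in>B. x v) = (\<Sum>v\<in>B. (\<Sum>w\<in>A. W v w) / n) + (\<Sum>v\<in>B. b v)"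
      unfolding x_def b_def by (simp only: split add_divide_distrib sum.distrib)
    then show ?thesis using BA n by (simp add: q_def algebra_simps)
  qed
  have xA: "(\<Sum>v\<in>A. x v) = n * (a\<^sup>2 - p' + p)"
  proof -
    have "(\<Sum>v\<in>A. x v) = card A * a - (\<Sum>v\<in>A. m v) + (\<Sum>v\<in>A. b v)"
      by (simp add: x_eq sum.distrib sum_subtractf)
    moreover have "real (card A) = n * a" "(\<Sum>v\<in>A. m v) = n * p'" "(\<Sum>v\<in>A. b v) = n * p"
      using n by (simp_all add: a_def p'_def p_def)
    ultimately have "(\<Sum>v\<in>A. x v) = n * a * a - n * p' + n * p" by simp
    then show ?thesis by (simp add: power2_eq_square algebra_simps)
  qed
  have d_eq: "d = a\<^sup>2 - p' + 2 * p + q"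
    unfolding d_x split xA xB using n by (simp add: field_simps)
  \<comment> \<open>On \<open>A\<close>, \<open>1 - x v = m v + (\<beta> - b v)\<close> with a
    nonnegative last term, so \<open>p'\<close> is at most the total deficit.\<close>
  have p'd: "p' \<le> star_delta r"
  proof -
    have "p' \<le> (\<Sum>v\<in>A. 1 - x v) / n"
      unfolding p'_def using n a\<beta> b\<beta> AB by (intro divide_right_mono sum_mono) (force simp: x_eq)+
    also have "\<dots> \<le> (\<Sum>v\<in>V. 1 - x v) / n"
      using n x1 AB V by (intro divide_right_mono sum_mono2) auto
    finally show ?thesis using d dx by linarith
  qed
  define C where "C = {v \<in> A. star_eta r < m v}"
  define D where "D = {v \<in> A. m v \<le> star_eta r}"
  have CD: "A = C \<union> D" "C \<inter> D = {}" "finite C" "finite D" "C \<subseteq> A" "D \<subseteq> A"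
    using AB by (auto simp: C_def D_def)
  have splitA: "sum f A = sum f C + sum f D" for f :: "'v \<Rightarrow> real"
    using CD by (simp add: sum.union_disjoint)
  define X where "X = (\<Sum>v\<in>C. m v) / n"
  \<comment> \<open>A missing pair starting in \<open>C\<close> has a reverse starting in
    \<open>D\<close> unless both ends lie in \<open>C\<close>. Hence \<open>X\<close> exceeds half
    of \<open>p'\<close> by at most half the density of pairs inside \<open>C\<close>, and
    \<open>C\<close> is small.\<close>
  have X: "X \<le> p' / 2 * (1 + 1 / (8 * real r))"
  proof -
    define \<gamma> where "\<gamma> = card C / n"
    have \<gamma>0: "0 \<le> \<gamma>" using n by (simp add: \<gamma>_def)
    have "\<gamma> * star_eta r = (\<Sum>v\<in>C. star_eta r) / n" by (simp add: \<gamma>_def)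
    also have "\<dots> \<le> (\<Sum>v\<in>C. m v) / n"
      using n by (intro divide_right_mono sum_mono) (auto simp: C_def)
    also have "\<dots> \<le> p'"
      unfolding p'_def using n m0 AB CD by (intro divide_right_mono sum_mono2) auto
    finally have \<gamma>: "\<gamma> * star_eta r \<le> p'" .
    \<comment> \<open>One factor is bounded by \<open>p'\<close>, the other one further by
      \<open>star_delta r\<close>.\<close>
    have "(\<gamma> * star_eta r) * (\<gamma> * star_eta r) \<le> p' * star_delta r"
      using \<gamma> p'd \<gamma>0 c nonneg by (intro mult_mono) auto
    then have "\<gamma>\<^sup>2 * (star_eta r)\<^sup>2 \<le> p' / (8 * real r) * (star_eta r)\<^sup>2"
      by (simp add: star_delta_def power2_eq_square mult_ac)
    then have \<gamma>2: "\<gamma>\<^sup>2 \<le> p' / (8 * real r)"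
      using mult_right_le_imp_le zero_less_power[OF c(1), of 2] by blast
    define M where "M S T = (\<Sum>v\<in>S. \<Sum>w\<in>T. 1 - W v w) / n\<^sup>2" for S T
    have MCD: "M C D = M D C"
      unfolding M_def by (subst sum.swap) (use sym AB CD in \<open>auto intro!: sum.cong arg_cong2[where f = "(/)"]\<close>)
    have "X = M C C + M C D"
      by (simp add: X_def m_def M_def splitA sum.distrib sum_divide_distrib[symmetric]
          add_divide_distrib power2_eq_square)
    moreover have "p' = M C C + M C D + M D C + M D D"
      by (simp add: p'_def m_def M_def splitA sum.distrib sum_divide_distrib[symmetric]
          add_divide_distrib power2_eq_square)
    moreover have "0 \<le> M D D"
      unfolding M_def using W1 AB CD n by (intro divide_nonneg_pos sum_nonneg) auto
    moreover have "M C C \<le> \<gamma>\<^sup>2"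
    proof -
      have "(\<Sum>v\<in>C. \<Sum>w\<in>C. 1 - W v w) \<le> (\<Sum>v\<in>C. \<Sum>w\<in>C. 1)"
        using W0 AB CD by (intro sum_mono) auto
      then show ?thesis
        using n by (simp add: M_def \<gamma>_def power2_eq_square divide_right_mono)
    qed
    ultimately have "2 * X \<le> p' + \<gamma>\<^sup>2" using MCD by linarith
    then show ?thesis using \<gamma>2 by (simp add: algebra_simps)
  qed
  have D: "(\<Sum>v\<in>D. m v) = n * (p' - X)"
    using splitA[of m] n by (simp add: p'_def X_def field_simps)
  have C: "(\<Sum>v\<in>C. m v) = n * X"
    using n by (simp add: X_def)
  have vertex: "x v ^ r \<le> a ^ r + real r * b v - (3 / 2 - 1 / 8) * m v"
    "m v \<le> star_eta r \<Longrightarrow> x v ^ r \<le> a ^ r + real r * b v - (real r - 1 / 8) * m v" if "v \<in> A" for v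
  proof -
    have v: "v \<in> V" "1 / 2 \<le> x v" using that by (auto simp: A_def)
    have "a + b v \<le> 1" using b\<beta>[OF v(1)] a\<beta> by linarith
    note * = star_vertex_bound[OF r b0[OF v(1)] this m0[OF v(1)] v(2)[unfolded x_eq] a_ge]
    show "x v ^ r \<le> a ^ r + real r * b v - (3 / 2 - 1 / 8) * m v"
      "m v \<le> star_eta r \<Longrightarrow> x v ^ r \<le> a ^ r + real r * b v - (real r - 1 / 8) * m v"
      unfolding x_eq using * by blast+
  qed
  define f where "f v = a ^ r + real r * b v" for v
  have f: "(\<Sum>v\<in>A. f v) = n * (a * a ^ r + real r * p)"
  proof -
    have "(\<Sum>v\<in>A. f v) = card A * a ^ r + real r * (\<Sum>v\<in>A. b v)"
      by (simp add: f_def sum.distrib sum_distrib_left)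
    then show ?thesis using n by (simp add: p_def a_def distrib_left)
  qed
  define Y where "Y = a * a ^ r + real r * p - (real r - 1 / 8) * (p' - X) - (3 / 2 - 1 / 8) * X"
  have "(\<Sum>v\<in>C. x v ^ r) \<le> (\<Sum>v\<in>C. f v - (3 / 2 - 1 / 8) * m v)"
    using vertex(1) CD by (intro sum_mono) (auto simp: f_def)
  also have "\<dots> = (\<Sum>v\<in>C. f v) - (3 / 2 - 1 / 8) * (n * X)"
    unfolding sum_subtractf sum_distrib_left[symmetric] C by simp
  finally have xC: "(\<Sum>v\<in>C. x v ^ r) \<le> (\<Sum>v\<in>C. f v) - (3 / 2 - 1 / 8) * (n * X)" .
  have "(\<Sum>v\<in>D. x v ^ r) \<le> (\<Sum>v\<in>D. f v - (real r - 1 / 8) * m v)"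
    using vertex(2) by (intro sum_mono) (auto simp: f_def D_def)
  also have "\<dots> = (\<Sum>v\<in>D. f v) - (real r - 1 / 8) * (n * (p' - X))"
    unfolding sum_subtractf sum_distrib_left[symmetric] D by simp
  finally have "(\<Sum>v\<in>A. x v ^ r)
      \<le> (\<Sum>v\<in>A. f v) - (real r - 1 / 8) * (n * (p' - X)) - (3 / 2 - 1 / 8) * (n * X)"
    using xC splitA[of "\<lambda>v. x v ^ r"] splitA[of f] by linarith
  also have "\<dots> = n * Y"
    unfolding f Y_def by (simp add: algebra_simps)
  finally have sumA: "(\<Sum>v\<in>A. x v ^ r) \<le> n * Y" .
  \<comment> \<open>Since \<open>r \<ge> 2\<close>, a factor \<open>x v \<le> 1/2\<close> can be
    split off. Pairs at \<open>B\<close> thus count half in the power sum, which gives the term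
    \<open>(p + q) / 2\<close>.\<close>
  have "x v ^ r \<le> x v / 2" if "v \<in> B" for v
  proof -
    have v: "0 \<le> x v" "x v \<le> 1 / 2" using that x0[of v] by (auto simp: B_def)
    have "x v ^ r \<le> x v ^ 2" using v r by (intro power_decreasing) auto
    also have "\<dots> \<le> x v * (1 / 2)" unfolding power2_eq_square using v by (intro mult_left_mono)
    finally show ?thesis by simp
  qed
  then have "(\<Sum>v\<in>B. x v ^ r) \<le> (\<Sum>v\<in>B. x v) / 2"
    unfolding sum_divide_distrib by (rule sum_mono)
  then have "(\<Sum>v\<in>V. x v ^ r) \<le> n * Y + n * (p + q) / 2"
    unfolding split using sumA xB by linarith
  also have "\<dots> = n * (Y + (p + q) / 2)" by (simp add: distrib_left)
  also have "\<dots> \<le> n * sqrt d ^ (r + 1)"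
    unfolding Y_def
  proof (intro mult_left_mono star_balance[OF r a_ge])
    show "(sqrt d)\<^sup>2 = a\<^sup>2 - p' + 2 * p + q" using d0 d_eq by simp
  qed (use X nonneg n d0 a\<beta> in auto)
  finally have main: "(\<Sum>v\<in>V. x v ^ r) \<le> n * sqrt d ^ (r + 1)" .
  have "(\<Sum>v\<in>V. (\<Sum>w\<in>V. W v w) ^ r) = n ^ r * (\<Sum>v\<in>V. x v ^ r)"
    using n by (simp add: x_def power_divide sum_divide_distrib[symmetric])
  also have "\<dots> \<le> n ^ r * (n * sqrt d ^ (r + 1))"
    using main n by (intro mult_left_mono) auto
  also have "\<dots> = (n * sqrt d) ^ (r + 1)"
    by (simp add: power_mult_distrib)
  also have "n * sqrt d = sqrt (\<Sum>v\<in>V. \<Sum>w\<in>V. W v w)"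
    using n by (simp add: d_def real_sqrt_divide)
  finally show ?thesis .
qed

text \<open>For \<open>r = 1\<close> both sides equal the total weight and \<open>c = 0\<close>
  serves; for larger \<open>r\<close> the constant is \<open>1 - star_delta r\<close>.\<close>

lemma kernel_star_bound:
  assumes "1 \<le> r"
  shows "\<exists>c<1. \<forall>(V :: 'v set) W. finite V \<and> V \<noteq> {} \<and>
      (\<forall>v\<in>V. \<forall>w\<in>V. W v w = W w v \<and> 0 \<le> W v w \<and> W v w \<le> 1) \<and>
      c * (real (card V))\<^sup>2 \<le> (\<Sum>v\<in>V. \<Sum>w\<in>V. W v w) \<longrightarrow>
      (\<Sum>v\<in>V. (\<Sum>w\<in>V. W v w) ^ r) \<le> sqrt (\<Sum>v\<in>V. \<Sum>w\<in>V. W v w) ^ (r + 1)"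
proof (cases "r = 1")
  case True
  have "0 \<le> (\<Sum>v\<in>V. \<Sum>w\<in>V. W v w)"
    if "\<forall>v\<in>V. \<forall>w\<in>V. W v w = W w v \<and> 0 \<le> W v w \<and> W v w \<le> 1"
    for V :: "'v set" and W :: "'v \<Rightarrow> 'v \<Rightarrow> real"
    using that by (intro sum_nonneg) auto
  then show ?thesis using True by (intro exI[of _ 0]) simp
next
  case False
  with assms have r: "2 \<le> r" by simp
  show ?thesis
  proof (intro exI[of _ "1 - star_delta r"] conjI allI impI)
    show "1 - star_delta r < 1" using star_constants(2)[OF r] by simp
  next
    fix V :: "'v set" and W :: "'v \<Rightarrow> 'v \<Rightarrow> real"
    assume *: "finite V \<and> V \<noteq> {} \<and>
      (\<forall>v\<in>V. \<forall>w\<in>V. W v w = W w v \<and> 0 \<le> W v w \<and> W v w \<le> 1) \<and>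
      (1 - star_delta r) * (real (card V))\<^sup>2 \<le> (\<Sum>v\<in>V. \<Sum>w\<in>V. W v w)"
    show "(\<Sum>v\<in>V. (\<Sum>w\<in>V. W v w) ^ r) \<le> sqrt (\<Sum>v\<in>V. \<Sum>w\<in>V. W v w) ^ (r + 1)"
      by (rule kernel_star_bound_ge_2[OF _ _ r]) (use * in blast)+
  qed
qed

section \<open>Homomorphisms from graphs without isolated vertices\<close>

definition degree :: "'v graph \<Rightarrow> 'v \<Rightarrow> nat" where
  "degree G v = card {w \<in> verts G. {v, w} \<in> edges G}"

lemma is_graphD:
  assumes "is_graph G"
  shows "finite (verts G)" "finite (edges G)" "\<And>e. e \<in> edges G \<Longrightarrow> e \<subseteq> verts G"
    "\<And>e. e \<in> edges G \<Longrightarrow> card e = 2"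
proof -
  have "finite (verts G)" and sub: "edges G \<subseteq> nsets (verts G) 2"
    using assms by (simp_all add: is_graph_def)
  then show "finite (verts G)" "finite (edges G)"
    using finite_subset[OF sub finite_imp_finite_nsets] by simp_all
  show "\<And>e. e \<in> edges G \<Longrightarrow> e \<subseteq> verts G" "\<And>e. e \<in> edges G \<Longrightarrow> card e = 2"
    using sub by (auto simp: nsets_def)
qed

lemma sum_degree:
  assumes G: "is_graph G"
  shows "(\<Sum>v\<in>verts G. degree G v) = 2 * card (edges G)"
proof -
  have "(\<Sum>v\<in>verts G. degree G v) = (\<Sum>v\<in>verts G. card {e \<in> edges G. v \<in> e})"
  proof (intro sum.cong refl)
    fix v assume v: "v \<in> verts G"
    have "bij_betw (\<lambda>w. {v, w}) {w \<in> verts G. {v, w} \<in> edges G} {e \<in> edges G. v \<in> e}"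
      unfolding bij_betw_def
    proof (intro conjI equalityI subsetI)
      show "inj_on (\<lambda>w. {v, w}) {w \<in> verts G. {v, w} \<in> edges G}"
        by (auto simp: inj_on_def doubleton_eq_iff)
      fix e assume e: "e \<in> {e \<in> edges G. v \<in> e}"
      then obtain x y where xy: "e = {x, y}"
        using is_graphD(4)[OF G, of e] by (auto simp: card_2_iff)
      then show "e \<in> (\<lambda>w. {v, w}) ` {w \<in> verts G. {v, w} \<in> edges G}"
        using e is_graphD(3)[OF G, of e] by (auto simp: insert_commute)
    qed auto
    then show "degree G v = card {e \<in> edges G. v \<in> e}"
      unfolding degree_def by (rule bij_betw_same_card)
  qed
  also have "\<dots> = (\<Sum>e\<in>edges G. card {v \<in> verts G. v \<in> e})"
    using sum.swap_restrict[OF is_graphD(1,2)[OF G], of "\<lambda>_ _. 1 :: nat" "\<lambda>v e. v \<in> e"] by simp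
  also have "\<dots> = (\<Sum>e\<in>edges G. 2)"
  proof (intro sum.cong refl)
    fix e assume e: "e \<in> edges G"
    then have "{v \<in> verts G. v \<in> e} = e" using is_graphD(3)[OF G e] by auto
    then show "card {v \<in> verts G. v \<in> e} = 2" using is_graphD(4)[OF G e] by simp
  qed
  finally show ?thesis by simp
qed

text \<open>The adjacency matrix is a kernel whose total is twice the number of edges. The largest
  of finitely many thresholds serves all exponents up to \<open>k\<close> at once.\<close>

lemma degree_power_sum_bound:
  "\<exists>c<1. \<forall>G :: 'v graph. is_graph G \<and> verts G \<noteq> {} \<and>
     c * (real (card (verts G)))\<^sup>2 \<le> 2 * real (card (edges G)) \<longrightarrow>
     (\<forall>r\<in>{1..k}. (\<Sum>v\<in>verts G. real (degree G v) ^ r) \<le> sqrt (2 * real (card (edges G))) ^ (r + 1))"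
proof -
  have "\<exists>c<1. \<forall>G :: 'v graph. is_graph G \<and> verts G \<noteq> {} \<and>
          c * (real (card (verts G)))\<^sup>2 \<le> 2 * real (card (edges G)) \<longrightarrow>
          (\<Sum>v\<in>verts G. real (degree G v) ^ r) \<le> sqrt (2 * real (card (edges G))) ^ (r + 1)"
    if r: "1 \<le> r" for r
  proof -
    from kernel_star_bound[OF r, where 'v = 'v] obtain c :: real where c: "c < 1"
      and bound: "\<forall>(V :: 'v set) W. finite V \<and> V \<noteq> {} \<and>
        (\<forall>v\<in>V. \<forall>w\<in>V. W v w = W w v \<and> 0 \<le> W v w \<and> W v w \<le> 1) \<and>
        c * (real (card V))\<^sup>2 \<le> (\<Sum>v\<in>V. \<Sum>w\<in>V. W v w) \<longrightarrow>
        (\<Sum>v\<in>V. (\<Sum>w\<in>V. W v w) ^ r) \<le> sqrt (\<Sum>v\<in>V. \<Sum>w\<in>V. W v w) ^ (r + 1)"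
      by (elim exE conjE)
    show ?thesis
    proof (intro exI[of _ c] conjI c allI impI)
      fix G :: "'v graph"
      assume *: "is_graph G \<and> verts G \<noteq> {} \<and>
        c * (real (card (verts G)))\<^sup>2 \<le> 2 * real (card (edges G))"
      then have G: "is_graph G" by simp
      define W where "W v w = (of_bool ({v, w} \<in> edges G) :: real)" for v w
      have deg: "(\<Sum>w\<in>verts G. W v w) = real (degree G v)" for v
        using is_graphD(1)[OF G] by (simp add: W_def degree_def sum.If_cases of_bool_def Int_def)
      have total: "(\<Sum>v\<in>verts G. real (degree G v)) = 2 * real (card (edges G))"
        using arg_cong[OF sum_degree[OF G], of real] by simp
      have "\<forall>v\<in>verts G. \<forall>w\<in>verts G. W v w = W w v \<and> 0 \<le> W v w \<and> W v w \<le> 1"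
        by (simp add: W_def insert_commute)
      then show "(\<Sum>v\<in>verts G. real (degree G v) ^ r) \<le> sqrt (2 * real (card (edges G))) ^ (r + 1)"
        using bound[rule_format, of "verts G" W] is_graphD(1)[OF G] *
        unfolding deg total by blast
    qed
  qed
  then obtain c where c: "\<And>r. 1 \<le> r \<Longrightarrow> c r < 1"
    and bound: "\<And>r (G :: 'v graph). 1 \<le> r \<Longrightarrow> is_graph G \<and> verts G \<noteq> {} \<and>
          c r * (real (card (verts G)))\<^sup>2 \<le> 2 * real (card (edges G)) \<longrightarrow>
          (\<Sum>v\<in>verts G. real (degree G v) ^ r) \<le> sqrt (2 * real (card (edges G))) ^ (r + 1)"
    by metis
  \<comment> \<open>The inserted 0 keeps the set nonempty when \<open>k = 0\<close>.\<close>
  define C where "C = Max (insert 0 (c ` {1..k}))"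
  show ?thesis
  proof (intro exI[of _ C] conjI allI impI ballI)
    show "C < 1" using c by (auto simp: C_def)
    fix G :: "'v graph" and r
    assume *: "is_graph G \<and> verts G \<noteq> {} \<and>
        C * (real (card (verts G)))\<^sup>2 \<le> 2 * real (card (edges G))" and r: "r \<in> {1..k}"
    have "c r \<le> C" unfolding C_def using r by (intro Max_ge) auto
    then have "c r * (real (card (verts G)))\<^sup>2 \<le> C * (real (card (verts G)))\<^sup>2"
      by (intro mult_right_mono) auto
    then show "(\<Sum>v\<in>verts G. real (degree G v) ^ r) \<le> sqrt (2 * real (card (edges G))) ^ (r + 1)"
      using bound[of r G] * r by auto
  qed
qed

section \<open>Counting homomorphisms by splitting off stars\<close>

text \<open>Extensional functions represent each map on \<open>verts H\<close> exactly once, so that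
  cardinalities count homomorphisms.\<close>

definition homs :: "'a graph \<Rightarrow> 'v graph \<Rightarrow> ('a \<Rightarrow> 'v) set" where
  "homs H G = {f \<in> verts H \<rightarrow>\<^sub>E verts G. \<forall>e\<in>edges H. f ` e \<in> edges G}"

lemma finite_homs: "finite (verts H) \<Longrightarrow> finite (verts G) \<Longrightarrow> finite (homs H G)"
  unfolding homs_def by (rule finite_subset[OF _ finite_PiE[of "verts H" "\<lambda>_. verts G"]]) auto

lemma restrict_in_homs:
  assumes "f \<in> homs H G" "verts H' \<subseteq> verts H" "edges H' \<subseteq> edges H"
    "\<And>e. e \<in> edges H' \<Longrightarrow> e \<subseteq> verts H'"
  shows "restrict f (verts H') \<in> homs H' G"
proof -
  have "restrict f (verts H') ` e = f ` e" if "e \<in> edges H'" for e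
    using assms(4)[OF that] by (intro image_cong) auto
  then show ?thesis using assms(1-3) by (auto simp: homs_def)
qed

text \<open>Edges are deleted until every remaining edge has an endpoint covered by no other edge; then
  every component is a star, and the stars are split off one by one.\<close>

lemma card_homs_le:
  fixes H :: "'a graph" and G :: "'v graph"
  assumes G: "finite (verts G)" and s: "0 \<le> s"
    and star: "\<And>r. 1 \<le> r \<Longrightarrow> r \<le> k \<Longrightarrow> (\<Sum>v\<in>verts G. real (degree G v) ^ r) \<le> s ^ (r + 1)"
    and "is_graph H" "\<Union>(edges H) = verts H" "card (verts H) \<le> k"
  shows "real (card (homs H G)) \<le> s ^ card (verts H)"
  using assms(4-6)
proof (induction "card (edges H)" arbitrary: H rule: less_induct)
  case less
  note HD = is_graphD[OF less.prems(1)]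
  consider "edges H = {}" | e where "e \<in> edges H" "\<Union>(edges H - {e}) = verts H"
    | "edges H \<noteq> {}" "\<And>e. e \<in> edges H \<Longrightarrow> \<Union>(edges H - {e}) \<noteq> verts H"
    by blast
  then show ?case
  proof cases
    case 1
    \<comment> \<open>Only the empty map remains, matching \<open>s ^ 0 = 1\<close>.\<close>
    then have "verts H = {}" using less.prems by auto
    then show ?thesis using 1 by (simp add: homs_def)
  next
    case (2 e)
    define H' where "H' = (verts H, edges H - {e})"
    have H': "verts H' = verts H" "edges H' = edges H - {e}"
      by (simp_all add: H'_def verts_def edges_def)
    have "homs H G \<subseteq> homs H' G" by (auto simp: homs_def H')
    then have "card (homs H G) \<le> card (homs H' G)"
      using HD(1) G by (intro card_mono finite_homs) (auto simp: H')
    moreover have "real (card (homs H' G)) \<le> s ^ card (verts H')"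
    proof (rule less.hyps)
      show "card (edges H') < card (edges H)"
        using 2(1) HD(2) unfolding H' by (intro card_Diff1_less)
      show "is_graph H'" using less.prems(1) by (auto simp: is_graph_def H')
    qed (use 2 less.prems H' in auto)
    ultimately show ?thesis by (simp add: H')
  next
    case 3
    have priv: "\<exists>z\<in>e. \<forall>e'\<in>edges H. z \<in> e' \<longrightarrow> e' = e" if e: "e \<in> edges H" for e
    proof -
      have "\<Union>(edges H - {e}) \<subseteq> verts H" using less.prems(2) by auto
      then obtain z where z: "z \<in> verts H" "z \<notin> \<Union>(edges H - {e})" using 3(2)[OF e] by blast
      then show ?thesis using less.prems(2) by blast
    qed
    obtain e0 where e0: "e0 \<in> edges H" using 3(1) by auto
    then obtain v where v: "v \<in> e0" "\<And>e'. e' \<in> edges H \<Longrightarrow> v \<in> e' \<Longrightarrow> e' = e0"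
      using priv by blast
    \<comment> \<open>The private end \<open>v\<close> is a leaf; the other end \<open>u\<close>
      becomes the centre of the star.\<close>
    obtain u where u: "e0 = {u, v}" "u \<noteq> v"
      using HD(4)[OF e0] v(1) by (auto simp: card_2_iff insert_commute)
    define L where "L = {w. {u, w} \<in> edges H}"
    \<comment> \<open>All neighbours of \<open>u\<close> are leaves: if the private end of
      \<open>{u, w}\<close> is \<open>u\<close> rather than \<open>w\<close>, then
      \<open>{u, w} = e0\<close>, so \<open>w\<close> is the leaf \<open>v\<close>.\<close>
    have L_priv: "e' = {u, w}" if w: "w \<in> L" and e': "e' \<in> edges H" "w \<in> e'" for w e'
    proof -
      have uw: "{u, w} \<in> edges H" using w by (simp add: L_def)
      then obtain z where z: "z \<in> {u, w}" "\<And>e'. e' \<in> edges H \<Longrightarrow> z \<in> e' \<Longrightarrow> e' = {u, w}"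
        using priv by blast
      show ?thesis
      proof (cases "z = w")
        case True
        then show ?thesis using z(2) e' by blast
      next
        case False
        then have "{u, v} = {u, w}" using z u e0 by auto
        then have "w = v" using u by (auto simp: doubleton_eq_iff)
        then show ?thesis using v(2) e' u by auto
      qed
    qed
    have uL: "u \<notin> L" using HD(4)[of "{u, u}"] by (auto simp: L_def)
    have vL: "v \<in> L" using e0 u by (simp add: L_def)
    have LU: "insert u L \<subseteq> verts H" using HD(3) e0 u by (fastforce simp: L_def)
    have fL: "finite L" using LU HD(1) finite_subset by auto
    define H' where "H' = (verts H - insert u L, {e \<in> edges H. u \<notin> e})"
    have H': "verts H' = verts H - insert u L" "edges H' = {e \<in> edges H. u \<notin> e}"
      by (simp_all add: H'_def verts_def edges_def)
    have sub': "e \<subseteq> verts H'" if "e \<in> edges H'" for e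
    proof
      fix z assume z: "z \<in> e"
      have e: "e \<in> edges H" "u \<notin> e" using that by (auto simp: H')
      then have "z \<notin> L" using L_priv[of z e] z by auto
      then show "z \<in> verts H'" using HD(3)[OF e(1)] z e(2) by (auto simp: H')
    qed
    have graph': "is_graph H'"
      using sub' HD by (auto simp: is_graph_def H' nsets_def intro: finite_subset)
    \<comment> \<open>Deleting the star uncovers no other vertex, as an edge through
      \<open>u\<close> would put its other end into \<open>L\<close>.\<close>
    have "verts H' \<subseteq> \<Union>(edges H')"
    proof
      fix z assume z: "z \<in> verts H'"
      then obtain e where e: "e \<in> edges H" "z \<in> e" using less.prems(2) by (auto simp: H')
      have "u \<notin> e"
      proof
        assume "u \<in> e"
        then have "e = {u, z}" using HD(4)[OF e(1)] e(2) z by (auto simp: card_2_iff H')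
        then show False using e z by (auto simp: H' L_def)
      qed
      then show "z \<in> \<Union>(edges H')" using e by (auto simp: H')
    qed
    then have cover': "\<Union>(edges H') = verts H'" using sub' by blast
    have "edges H' \<subset> edges H" using e0 u by (auto simp: H')
    then have less': "card (edges H') < card (edges H)" using HD(2) by (rule psubset_card_mono[rotated])
    have card: "card (verts H) = card L + 1 + card (verts H')"
      using LU uL fL HD(1) card_mono[OF HD(1) LU] by (simp add: H' card_Diff_subset)
    have IH: "real (card (homs H' G)) \<le> s ^ card (verts H')"
      using less.hyps[OF less' graph' cover'] less.prems(3) card by linarith
    define N where "N x = {y \<in> verts G. {x, y} \<in> edges G}" for x
    \<comment> \<open>A homomorphism is determined by the image \<open>x\<close> of the centre, the
      images of the leaves among the neighbours of \<open>x\<close>, and its restriction to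
      \<open>H'\<close>. Summing over \<open>x\<close> yields the power sum of degrees with exponent
      \<open>card L\<close>.\<close>
    define T where "T = (SIGMA x:verts G. (L \<rightarrow>\<^sub>E N x) \<times> homs H' G)"
    have finN: "finite (N x)" for x using G by (simp add: N_def)
    have finH': "finite (homs H' G)" using HD(1) G by (intro finite_homs) (simp_all add: H')
    have "card (homs H G) \<le> card T"
    proof (rule card_inj_on_le)
      show "finite T" unfolding T_def using G finN fL finH' by (intro finite_SigmaI finite_cartesian_product finite_PiE)
      show "(\<lambda>f. (f u, restrict f L, restrict f (verts H'))) ` homs H G \<subseteq> T"
      proof (rule image_subsetI)
        fix f assume f: "f \<in> homs H G"
        have "f w \<in> N (f u)" if "w \<in> L" for w
        proof -
          have "f ` {u, w} \<in> edges G" "w \<in> verts H"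
            using f that LU by (auto simp: homs_def L_def simp del: image_insert)
          then show ?thesis using f by (auto simp: N_def homs_def)
        qed
        moreover have "f u \<in> verts G" using f LU by (auto simp: homs_def)
        moreover have "restrict f (verts H') \<in> homs H' G"
          by (rule restrict_in_homs[OF f _ _ sub']) (auto simp: H')
        ultimately show "(f u, restrict f L, restrict f (verts H')) \<in> T"
          by (auto simp: T_def)
      qed
      show "inj_on (\<lambda>f. (f u, restrict f L, restrict f (verts H'))) (homs H G)"
      proof (rule inj_onI)
        fix f g assume fg: "f \<in> homs H G" "g \<in> homs H G"
          "(f u, restrict f L, restrict f (verts H')) = (g u, restrict g L, restrict g (verts H'))"
        have "f x = g x" if "x \<in> verts H" for x
        proof -
          have "x = u \<or> x \<in> L \<or> x \<in> verts H'" using that by (auto simp: H')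
          then show ?thesis using fg(3) by (metis Pair_inject restrict_apply')
        qed
        then show "f = g" using fg(1,2) unfolding homs_def by (auto intro: PiE_ext)
      qed
    qed
    also have "card T = (\<Sum>x\<in>verts G. degree G x ^ card L * card (homs H' G))"
      unfolding T_def using G finN fL finH'
      by (simp add: card_SigmaI finite_PiE card_cartesian_product card_PiE N_def degree_def)
    finally have "real (card (homs H G))
        \<le> (\<Sum>x\<in>verts G. real (degree G x) ^ card L) * real (card (homs H' G))"
      by (simp add: sum_distrib_right[symmetric] flip: of_nat_mult of_nat_power of_nat_sum)
    also have "\<dots> \<le> s ^ (card L + 1) * s ^ card (verts H')"
    proof (intro mult_mono IH star)
      show "1 \<le> card L" using vL fL by (simp add: Suc_le_eq card_gt_0_iff) auto
    qed (use card less.prems(3) s in auto)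
    also have "\<dots> = s ^ card (verts H)" unfolding card by (simp add: power_add)
    finally show ?thesis .
  qed
qed

section \<open>Embeddings and copies\<close>

definition embeddings :: "'a graph \<Rightarrow> 'v graph \<Rightarrow> ('a \<Rightarrow> 'v) set" where
  "embeddings H G = {f \<in> homs H G. inj_on f (verts H)}"

definition image_graph :: "('a \<Rightarrow> 'v) \<Rightarrow> 'a graph \<Rightarrow> 'v graph" where
  "image_graph f H = (f ` verts H, (`) f ` edges H)"

lemma image_graph_simps [simp]:
  "verts (image_graph f H) = f ` verts H" "edges (image_graph f H) = (`) f ` edges H"
  by (simp_all add: image_graph_def verts_def edges_def)

lemma graph_eqI: "verts S = verts T \<Longrightarrow> edges S = edges T \<Longrightarrow> S = T"
  by (simp add: verts_def edges_def prod_eq_iff)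

text \<open>An isomorphism onto a subgraph, cut down to \<open>verts H\<close>, is an embedding.
  Conversely, an injective map reflects edges of its image graph, because that graph has only images
  of edges of \<open>H\<close>.\<close>

lemma copies_eq_image_embeddings:
  assumes H: "is_graph H"
  shows "{S. subgraph_of S G \<and> graph_iso H S} = (\<lambda>f. image_graph f H) ` embeddings H G"
proof (intro equalityI subsetI)
  note HD = is_graphD[OF H]
  fix S assume "S \<in> {S. subgraph_of S G \<and> graph_iso H S}"
  then obtain f where S: "is_graph S" "verts S \<subseteq> verts G" "edges S \<subseteq> edges G"
    and f: "bij_betw f (verts H) (verts S)"
      "\<And>u v. u \<in> verts H \<Longrightarrow> v \<in> verts H \<Longrightarrow> {u, v} \<in> edges H \<longleftrightarrow> {f u, f v} \<in> edges S"
    by (auto simp: subgraph_of_def graph_iso_def)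
  define g where "g = restrict f (verts H)"
  have gim: "g ` X = f ` X" if "X \<subseteq> verts H" for X
    using that by (intro image_cong) (auto simp: g_def)
  have edge: "f ` e \<in> edges S" if e: "e \<in> edges H" for e
  proof -
    obtain u v where "e = {u, v}" using HD(4)[OF e] by (auto simp: card_2_iff)
    then show ?thesis using f(2)[of u v] HD(3)[OF e] e by auto
  qed
  have "edges S \<subseteq> (`) f ` edges H"
  proof
    fix e assume e: "e \<in> edges S"
    obtain x y where xy: "e = {x, y}" using is_graphD(4)[OF S(1) e] by (auto simp: card_2_iff)
    then have "x \<in> f ` verts H" "y \<in> f ` verts H"
      using is_graphD(3)[OF S(1) e] f(1) by (auto simp: bij_betw_def)
    then obtain u v where "u \<in> verts H" "v \<in> verts H" "x = f u" "y = f v" by blast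
    then show "e \<in> (`) f ` edges H"
      using f(2)[of u v] e xy by (intro image_eqI[of _ _ "{u, v}"]) auto
  qed
  then have "edges S = (`) f ` edges H" using edge by auto
  also have "\<dots> = (`) g ` edges H" using gim HD(3) by (simp cong: image_cong_simp)
  finally have ES: "edges S = (`) g ` edges H" .
  have "S = image_graph g H"
    using ES gim[of "verts H"] f(1)
    by (intro graph_eqI) (auto simp: bij_betw_def)
  moreover have "g \<in> embeddings H G"
    using S f(1) ES by (auto simp: embeddings_def homs_def g_def bij_betw_def inj_on_def)
  ultimately show "S \<in> (\<lambda>f. image_graph f H) ` embeddings H G" by blast
next
  note HD = is_graphD[OF H]
  fix S assume "S \<in> (\<lambda>f. image_graph f H) ` embeddings H G"
  then obtain f where S: "S = image_graph f H" and f: "f \<in> embeddings H G" by blast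
  have VS: "verts S = f ` verts H" and ES: "edges S = (`) f ` edges H"
    by (simp_all add: S)
  have inj: "inj_on f (verts H)" using f by (simp add: embeddings_def)
  have "card (f ` e) = 2" if "e \<in> edges H" for e
    using HD(3,4)[OF that] card_image[OF inj_on_subset[OF inj]] by auto
  then have "is_graph S"
    using HD(1,3) by (auto simp: is_graph_def VS ES nsets_def intro: card_ge_0_finite)
  moreover have "{u, v} \<in> edges H \<longleftrightarrow> {f u, f v} \<in> edges S" if "u \<in> verts H" "v \<in> verts H" for u v
  proof
    assume "{f u, f v} \<in> edges S"
    then obtain e where e: "e \<in> edges H" "f ` e = f ` {u, v}" by (auto simp: ES)
    then have "e = {u, v}"
      using inj_on_image_eq_iff[OF inj HD(3)[OF e(1)], of "{u, v}"] that by auto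
    then show "{u, v} \<in> edges H" using e by simp
  qed (auto simp: ES image_iff intro!: bexI[of _ "{u, v}"])
  ultimately show "S \<in> {S. subgraph_of S G \<and> graph_iso H S}"
    using f inj by (auto simp: subgraph_of_def graph_iso_def embeddings_def homs_def VS ES
        intro!: exI[of _ f] inj_on_imp_bij_betw)
qed

text \<open>Embeddings with the same image graph differ by an automorphism of \<open>H\<close>:
  composing \<open>g\<close> with the automorphisms gives each of them exactly once.\<close>

lemma card_embeddings_fiber:
  assumes H: "is_graph H" and g: "g \<in> embeddings H G"
  shows "card {f \<in> embeddings H G. image_graph f H = image_graph g H}
       = card {f \<in> embeddings H H. image_graph f H = H}"
proof -
  note HD = is_graphD[OF H]
  have gi: "inj_on g (verts H)" and gV: "g \<in> verts H \<rightarrow>\<^sub>E verts G"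
    and gE: "\<And>e. e \<in> edges H \<Longrightarrow> g ` e \<in> edges G"
    using g by (auto simp: embeddings_def homs_def)
  have comp: "compose (verts H) g f ` X = g ` (f ` X)" if "X \<subseteq> verts H" for f :: "'a \<Rightarrow> 'a" and X
    using that by (auto simp: compose_def image_iff)
  have "bij_betw (compose (verts H) g) {f \<in> embeddings H H. image_graph f H = H}
      {f \<in> embeddings H G. image_graph f H = image_graph g H}"
    unfolding bij_betw_def
  proof (intro conjI equalityI subsetI)
    show "inj_on (compose (verts H) g) {f \<in> embeddings H H. image_graph f H = H}"
    proof (rule inj_onI)
      fix f f' assume *: "f \<in> {f \<in> embeddings H H. image_graph f H = H}"
        "f' \<in> {f \<in> embeddings H H. image_graph f H = H}"
        "compose (verts H) g f = compose (verts H) g f'"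
      then have ff: "f \<in> verts H \<rightarrow>\<^sub>E verts H" "f' \<in> verts H \<rightarrow>\<^sub>E verts H"
        by (auto simp: embeddings_def homs_def)
      have "f x = f' x" if "x \<in> verts H" for x
        using fun_cong[OF *(3), of x] that ff gi by (auto simp: compose_def inj_on_def)
      then show "f = f'" using ff by (auto intro: PiE_ext)
    qed
  next
    fix h assume "h \<in> compose (verts H) g ` {f \<in> embeddings H H. image_graph f H = H}"
    then obtain f where h: "h = compose (verts H) g f" and fi: "inj_on f (verts H)"
      and fV: "f \<in> verts H \<rightarrow>\<^sub>E verts H" and fE: "\<And>e. e \<in> edges H \<Longrightarrow> f ` e \<in> edges H"
      and fix_H: "image_graph f H = H"
      by (auto simp: embeddings_def homs_def)
    have fH: "f ` verts H = verts H" "(`) f ` edges H = edges H"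
      using arg_cong[OF fix_H, of verts] arg_cong[OF fix_H, of edges] by simp_all
    have "h ` e \<in> edges G" if "e \<in> edges H" for e
      using comp[OF HD(3)[OF that], of f] gE fE that by (simp add: h)
    moreover have "h \<in> verts H \<rightarrow>\<^sub>E verts G" using gV fV by (auto simp: h compose_def)
    moreover have "inj_on h (verts H)"
      using gi fi fH by (simp add: h inj_on_compose bij_betw_def inj_on_def compose_def) blast
    moreover have "(`) h ` edges H = (`) g ` ((`) f ` edges H)"
      using comp[OF HD(3)] by (simp add: h image_image)
    ultimately show "h \<in> {f \<in> embeddings H G. image_graph f H = image_graph g H}"
      using comp[of "verts H" f] by (auto simp: embeddings_def homs_def image_graph_def fH h)
  next
    fix h assume "h \<in> {f \<in> embeddings H G. image_graph f H = image_graph g H}"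
    then have hi: "inj_on h (verts H)" and hV: "h \<in> verts H \<rightarrow>\<^sub>E verts G"
      and hH: "h ` verts H = g ` verts H" "(`) h ` edges H = (`) g ` edges H"
      by (auto simp: embeddings_def homs_def image_graph_def)
    \<comment> \<open>The automorphism is the inverse of \<open>g\<close> after \<open>h\<close>,
      available because both have the same image.\<close>
    define f where "f = restrict (\<lambda>x. inv_into (verts H) g (h x)) (verts H)"
    have fV: "f x \<in> verts H" "g (f x) = h x" if "x \<in> verts H" for x
    proof -
      have "h x \<in> g ` verts H" using that hH by blast
      then show "f x \<in> verts H" "g (f x) = h x"
        using that by (simp_all add: f_def inv_into_into f_inv_into_f)
    qed
    have fP: "f \<in> verts H \<rightarrow>\<^sub>E verts H" using fV(1) by (auto simp: f_def)
    have gf: "g ` (f ` X) = h ` X" if "X \<subseteq> verts H" for X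
      using that fV(2) by (force simp: image_image)
    have fsub: "f ` X \<subseteq> verts H" if "X \<subseteq> verts H" for X using that fV(1) by auto
    have fi: "inj_on f (verts H)"
      using hi fV(2) by (metis inj_on_def)
    have f_edge: "f ` e = e'" if "e \<in> edges H" "e' \<in> edges H" "h ` e = g ` e'" for e e'
    proof -
      have "g ` (f ` e) = g ` e'" using gf[OF HD(3)] that by simp
      then show ?thesis
        using inj_on_image_eq_iff[OF gi fsub[OF HD(3)] HD(3)] that by blast
    qed
    have fE1: "f ` e \<in> edges H" if e: "e \<in> edges H" for e
    proof -
      have "h ` e \<in> (`) g ` edges H" using hH(2) e by blast
      then show ?thesis using f_edge[OF e] by auto
    qed
    have fE2: "e' \<in> (`) f ` edges H" if e': "e' \<in> edges H" for e'
    proof -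
      have "g ` e' \<in> (`) h ` edges H" using hH(2) e' by blast
      then obtain e where "e \<in> edges H" "h ` e = g ` e'" by auto
      then show ?thesis using f_edge[of e e'] e' by auto
    qed
    have "f ` verts H = verts H"
      using gf[of "verts H"] hH(1) inj_on_image_eq_iff[OF gi fsub, of "verts H" "verts H"] by simp
    then have "image_graph f H = H"
      using fE1 fE2 by (intro graph_eqI) auto
    moreover have "f \<in> embeddings H H"
      using fP fi fE1 by (auto simp: embeddings_def homs_def)
    moreover have "h = compose (verts H) g f"
      using hV fV(2) by (intro ext) (auto simp: compose_def PiE_def extensional_def)
    ultimately show "h \<in> compose (verts H) g ` {f \<in> embeddings H H. image_graph f H = H}"
      by blast
  qed
  then show ?thesis by (rule bij_betw_same_card[symmetric])
qed

lemma card_embeddings: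
  assumes H: "is_graph H" and G: "finite (verts G)"
  shows "card (embeddings H G) = card {f \<in> embeddings H H. image_graph f H = H} * num_copies H G"
proof -
  have fin: "finite (embeddings H G)"
    using finite_homs[OF is_graphD(1)[OF H] G] by (simp add: embeddings_def)
  have "card (embeddings H G) = (\<Sum>S\<in>(\<lambda>f. image_graph f H) ` embeddings H G.
      card {f \<in> embeddings H G. image_graph f H = S})"
    using sum.image_gen[OF fin, of "\<lambda>_. 1 :: nat" "\<lambda>f. image_graph f H"] by simp
  also have "\<dots> = (\<Sum>S\<in>(\<lambda>f. image_graph f H) ` embeddings H G.
      card {f \<in> embeddings H H. image_graph f H = H})"
  proof (rule sum.cong[OF refl])
    fix S assume "S \<in> (\<lambda>f. image_graph f H) ` embeddings H G"
    then obtain g where "g \<in> embeddings H G" "S = image_graph g H" by blast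
    then show "card {f \<in> embeddings H G. image_graph f H = S}
        = card {f \<in> embeddings H H. image_graph f H = H}"
      using card_embeddings_fiber[OF H, of g G] by simp
  qed
  finally show ?thesis
    by (simp add: num_copies_def copies_eq_image_embeddings[OF H])
qed

lemma card_automorphisms_pos:
  assumes H: "is_graph H"
  shows "0 < card {f \<in> embeddings H H. image_graph f H = H}"
proof -
  have im: "restrict id (verts H) ` X = X" if "X \<subseteq> verts H" for X
    using that by force
  have "(`) (restrict id (verts H)) ` edges H = edges H"
    using im is_graphD(3)[OF H] by force
  then have "image_graph (restrict id (verts H)) H = H"
    using im[of "verts H"] by (intro graph_eqI) simp_all
  moreover have "restrict id (verts H) \<in> embeddings H H"
    using im is_graphD(3)[OF H] by (auto simp: embeddings_def homs_def)
  moreover have "finite (embeddings H H)"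
    using finite_homs[OF is_graphD(1)[OF H] is_graphD(1)[OF H]] by (simp add: embeddings_def)
  ultimately show ?thesis by (auto simp: card_gt_0_iff)
qed

section \<open>Upper and lower bounds for embeddings\<close>

text \<open>Injectivity is dropped. Each isolated vertex of \<open>H\<close> has at most
  \<open>card (verts G)\<close> images, and the vertices on edges span a graph to which
  \<open>card_homs_le\<close> applies.\<close>

lemma card_embeddings_le:
  assumes H: "is_graph H" and G: "finite (verts G)" and s: "0 \<le> s"
    and star: "\<And>r. 1 \<le> r \<Longrightarrow> r \<le> card (verts H) \<Longrightarrow>
      (\<Sum>v\<in>verts G. real (degree G v) ^ r) \<le> s ^ (r + 1)"
  shows "real (card (embeddings H G))
       \<le> s ^ card (\<Union>(edges H)) * real (card (verts G)) ^ card (verts H - \<Union>(edges H))"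
proof -
  note HD = is_graphD[OF H]
  define U where "U = \<Union>(edges H)"
  define I where "I = verts H - U"
  define H' where "H' = (U, edges H)"
  have H': "verts H' = U" "edges H' = edges H" by (simp_all add: H'_def verts_def edges_def)
  have UV: "U \<subseteq> verts H" using HD(3) by (auto simp: U_def)
  have graph': "is_graph H'"
    unfolding is_graph_def H'
  proof (intro conjI subsetI)
    show "finite U" using UV HD(1) by (rule finite_subset)
    fix e assume e: "e \<in> edges H"
    then have "finite e" using HD(4)[OF e] by (intro card_ge_0_finite) simp
    then show "e \<in> nsets U 2" using e HD(4)[OF e] by (auto simp: nsets_def U_def)
  qed
  have fin: "finite I" "finite (homs H' G)"
    using HD(1) G is_graphD(1)[OF graph'] by (auto simp: I_def intro: finite_homs)
  have "card (embeddings H G) \<le> card (homs H' G \<times> (I \<rightarrow>\<^sub>E verts G))"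
  proof (rule card_inj_on_le)
    show "finite (homs H' G \<times> (I \<rightarrow>\<^sub>E verts G))" using fin G by (simp add: finite_PiE)
    show "(\<lambda>f. (restrict f U, restrict f I)) ` embeddings H G \<subseteq> homs H' G \<times> (I \<rightarrow>\<^sub>E verts G)"
    proof (rule image_subsetI)
      fix f assume "f \<in> embeddings H G"
      then have f: "f \<in> homs H G" by (simp add: embeddings_def)
      have "restrict f (verts H') \<in> homs H' G"
        using UV by (intro restrict_in_homs[OF f]) (auto simp: H' U_def)
      moreover have "restrict f I \<in> I \<rightarrow>\<^sub>E verts G" using f by (auto simp: homs_def I_def)
      ultimately show "(restrict f U, restrict f I) \<in> homs H' G \<times> (I \<rightarrow>\<^sub>E verts G)" by (simp add: H')
    qed
    show "inj_on (\<lambda>f. (restrict f U, restrict f I)) (embeddings H G)"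
    proof (rule inj_onI)
      fix f g assume fg: "f \<in> embeddings H G" "g \<in> embeddings H G"
        "(restrict f U, restrict f I) = (restrict g U, restrict g I)"
      have "f x = g x" if "x \<in> verts H" for x
        using fg(3) that by (metis DiffI I_def Pair_inject restrict_apply')
      then show "f = g" using fg(1,2) unfolding embeddings_def homs_def by (auto intro: PiE_ext)
    qed
  qed
  also have "\<dots> = card (homs H' G) * card (verts G) ^ card I"
    using fin by (simp add: card_cartesian_product card_PiE)
  finally have "real (card (embeddings H G)) \<le> real (card (homs H' G)) * real (card (verts G)) ^ card I"
    by (simp flip: of_nat_mult of_nat_power)
  also have "\<dots> \<le> s ^ card (verts H') * real (card (verts G)) ^ card I"
  proof (intro mult_right_mono card_homs_le[OF G s])
    show "card (verts H') \<le> card (verts H)" using UV HD(1) by (simp add: H' card_mono)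
  qed (use star graph' in \<open>auto simp: H' U_def\<close>)
  finally show ?thesis by (simp add: H' U_def I_def)
qed

text \<open>Values are chosen one argument at a time, with at most \<open>k\<close> already taken. A
  fixed \<open>k\<close> keeps all factors unchanged in the induction; truncated subtraction turns a
  factor into 0 when \<open>S x\<close> is small.\<close>

lemma card_inj_PiE_ge:
  fixes S :: "'a \<Rightarrow> 'b set"
  assumes "finite A" "\<And>x. x \<in> A \<Longrightarrow> finite (S x)" "card A \<le> k"
  shows "(\<Prod>x\<in>A. card (S x) - k) \<le> card {f \<in> Pi\<^sub>E A S. inj_on f A}"
  using assms
proof (induction A rule: finite_induct)
  case (insert x A)
  let ?F = "\<lambda>A. {f \<in> Pi\<^sub>E A S. inj_on f A}"
  define T where "T = (SIGMA f:?F A. S x - f ` A)"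
  have finF: "finite (?F B)" if "B \<subseteq> insert x A" for B
  proof -
    have "finite (Pi\<^sub>E B S)"
      using that insert.hyps(1) insert.prems(1) by (intro finite_PiE) (auto intro: finite_subset)
    then show ?thesis by simp
  qed
  have "(\<Prod>y\<in>insert x A. card (S y) - k) \<le> card (?F A) * (card (S x) - k)"
    using insert by (simp add: mult.commute)
  also have "\<dots> = (\<Sum>f\<in>?F A. card (S x) - k)" by simp
  also have "\<dots> \<le> (\<Sum>f\<in>?F A. card (S x - f ` A))"
  proof (rule sum_mono)
    fix f :: "'a \<Rightarrow> 'b"
    have "card (f ` A) \<le> k" using card_image_le[OF insert.hyps(1), of f] insert by simp
    moreover have "card (S x) - card (f ` A) \<le> card (S x - f ` A)"
      using insert.hyps(1) by (intro diff_card_le_card_Diff) auto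
    ultimately show "card (S x) - k \<le> card (S x - f ` A)" by linarith
  qed
  also have "\<dots> = card T"
    unfolding T_def using finF[of A] insert.prems(1) by (subst card_SigmaI) auto
  also have "\<dots> \<le> card (?F (insert x A))"
  proof (rule card_inj_on_le)
    show "finite (?F (insert x A))" by (rule finF) simp
    show "inj_on (\<lambda>(f, y). f(x := y)) T"
    proof (rule inj_onI, clarify)
      fix f y g z assume *: "(f, y) \<in> T" "(g, z) \<in> T" "f(x := y) = g(x := z)"
      have "y = z" using fun_cong[OF *(3), of x] by simp
      moreover have "f w = g w" for w
      proof (cases "w = x")
        case True
        then show ?thesis using *(1,2) insert.hyps(2) by (auto simp: T_def PiE_def extensional_def)
      next
        case False
        then show ?thesis using fun_cong[OF *(3), of w] by simp
      qed
      ultimately show "f = g \<and> y = z" by auto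
    qed
    show "(\<lambda>(f, y). f(x := y)) ` T \<subseteq> ?F (insert x A)"
    proof (rule image_subsetI, clarify)
      fix f y assume fy: "(f, y) \<in> T"
      then have "f(x := y) \<in> Pi\<^sub>E (insert x A) S"
        by (auto simp: T_def PiE_def extensional_def Pi_def)
      moreover have "inj_on (f(x := y)) (insert x A)"
        using fy insert.hyps(2) by (auto simp: T_def inj_on_def)
      ultimately show "f(x := y) \<in> Pi\<^sub>E (insert x A) S \<and> inj_on (f(x := y)) (insert x A)" by blast
    qed
  qed
  finally show ?case .
qed simp

text \<open>Vertices on edges of \<open>H\<close> are sent into the clique, where adjacency is
  automatic, and isolated ones anywhere. The exponents agree with those in
  \<open>card_embeddings_le\<close>.\<close>

lemma card_embeddings_quasi_clique_ge:
  assumes H: "is_graph H" and e: "e = (a choose 2) + b" "b < a" and an: "a \<le> n"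
  shows "(a - card (verts H)) ^ card (\<Union>(edges H)) * (n - card (verts H)) ^ card (verts H - \<Union>(edges H))
       \<le> card (embeddings H (quasi_clique n e))"
proof -
  note HD = is_graphD[OF H]
  define U where "U = \<Union>(edges H)"
  define S where "S v = (if v \<in> U then {..<a} else {..<n})" for v
  have UV: "U \<subseteq> verts H" using HD(3) by (auto simp: U_def)
  have Q: "verts (quasi_clique n e) = {..<n}" "nsets {..<a} 2 \<subseteq> edges (quasi_clique n e)"
    using quasi_clique_params_eqI[OF e] by (auto simp: quasi_clique_def verts_def edges_def)
  have "(a - card (verts H)) ^ card U * (n - card (verts H)) ^ card (verts H - U)
      = (\<Prod>v\<in>U. card (S v) - card (verts H)) * (\<Prod>v\<in>verts H - U. card (S v) - card (verts H))"
    by (simp add: S_def)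
  also have "\<dots> = (\<Prod>v\<in>verts H. card (S v) - card (verts H))"
    by (subst mult.commute) (rule prod.subset_diff[OF UV HD(1), symmetric])
  also have "\<dots> \<le> card {f \<in> Pi\<^sub>E (verts H) S. inj_on f (verts H)}"
    using HD(1) by (intro card_inj_PiE_ge) (auto simp: S_def)
  also have "\<dots> \<le> card (embeddings H (quasi_clique n e))"
  proof (intro card_mono subsetI)
    show "finite (embeddings H (quasi_clique n e))"
      using finite_homs[OF HD(1), of "quasi_clique n e"] Q(1) by (simp add: embeddings_def)
    fix f assume "f \<in> {f \<in> Pi\<^sub>E (verts H) S. inj_on f (verts H)}"
    then have f: "f \<in> Pi\<^sub>E (verts H) S" "inj_on f (verts H)" by auto
    have "f ` d \<in> edges (quasi_clique n e)" if d: "d \<in> edges H" for d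
    proof -
      have "card (f ` d) = 2"
        using HD(3,4)[OF d] card_image[OF inj_on_subset[OF f(2)], of d] by simp
      moreover have "f x < a" if "x \<in> d" for x
      proof -
        have "x \<in> U" using that d by (auto simp: U_def)
        then show ?thesis using PiE_mem[OF f(1), of x] UV by (auto simp: S_def)
      qed
      ultimately have "f ` d \<in> nsets {..<a} 2"
        by (auto simp: nsets_def intro: card_ge_0_finite)
      then show ?thesis using Q(2) by blast
    qed
    moreover have "f \<in> verts H \<rightarrow>\<^sub>E verts (quasi_clique n e)"
    proof (rule PiE_I)
      fix x assume "x \<in> verts H"
      then show "f x \<in> verts (quasi_clique n e)"
        using PiE_mem[OF f(1), of x] an by (auto simp: S_def Q(1) split: if_splits)
    qed (use f(1) in \<open>auto simp: PiE_def extensional_def\<close>)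
    ultimately show "f \<in> embeddings H (quasi_clique n e)"
      using f(2) by (simp add: embeddings_def homs_def)
  qed
  finally show ?thesis by (simp add: U_def)
qed

section \<open>Comparison with the quasi-clique\<close>

lemma two_choose_two: "2 * real (n choose 2) = real n * (real n - 1)"
proof (induction n)
  case (Suc n)
  have "real (Suc n choose 2) = real (n choose 2) + real n"
    by (simp only: choose_two_Suc of_nat_add)
  then show ?case using Suc by (simp add: algebra_simps)
qed (simp add: binomial_eq_0)

text \<open>For comparing \<open>a + 1\<close>, which bounds \<open>sqrt (2 * real e)\<close>, with
  the \<open>a - h\<close> from the lower bound for embeddings into the quasi-clique.\<close>

lemma eventually_ratio_power_le:
  fixes \<epsilon> :: real
  assumes "0 < \<epsilon>"
  shows "\<forall>\<^sub>F a in sequentially. ((real a + 1) / (real a - real h)) ^ h \<le> 1 + \<epsilon>"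
proof -
  have "(\<lambda>a. (real h + 1) / real (Suc a)) \<longlonglongrightarrow> 0"
    by (rule LIMSEQ_Suc[OF lim_const_over_n])
  from tendsto_add[OF tendsto_const[of 1] this]
  have "(\<lambda>a. 1 + (real h + 1) / real (Suc a)) \<longlonglongrightarrow> 1 + 0" .
  \<comment> \<open>Shifting the index by \<open>h + 1\<close> keeps the denominator
    positive.\<close>
  moreover have "1 + (real h + 1) / real (Suc a)
      = (real (a + (h + 1)) + 1) / (real (a + (h + 1)) - real h)" for a
    by (simp add: field_simps)
  ultimately have "(\<lambda>a. (real (a + (h + 1)) + 1) / (real (a + (h + 1)) - real h)) \<longlonglongrightarrow> 1"
    by simp
  then have "(\<lambda>a. (real a + 1) / (real a - real h)) \<longlonglongrightarrow> 1"
    by (rule LIMSEQ_offset)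
  then have "(\<lambda>a. ((real a + 1) / (real a - real h)) ^ h) \<longlonglongrightarrow> 1 ^ h" by (rule tendsto_power)
  then have "\<forall>\<^sub>F a in sequentially. ((real a + 1) / (real a - real h)) ^ h < 1 + \<epsilon>"
    using assms by (intro order_tendstoD) auto
  then show ?thesis by (rule eventually_mono) simp
qed

theorem theorem1p2:
  fixes H :: "'a graph"
  assumes "is_graph H"
  shows "\<exists>c::real. 0 < c \<and> c < 1 \<and>
    (\<forall>\<epsilon>>0. \<forall>\<^sub>F n in sequentially. \<forall>e::nat.
       c * real (n choose 2) \<le> real e \<and> e \<le> n choose 2 \<longrightarrow>
       \<bar>real (ex_copies n e H) - real (num_copies H (quasi_clique n e))\<bar>
         \<le> \<epsilon> * real (num_copies H (quasi_clique n e)))"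
proof -
  define h where "h = card (verts H)"
  define m where "m = card (\<Union>(edges H))"
  define l where "l = card (verts H - \<Union>(edges H))"
  have ml: "m + l = h"
  proof -
    have sub: "\<Union>(edges H) \<subseteq> verts H" using is_graphD(3)[OF assms] by auto
    then show ?thesis
      using card_Diff_subset[OF finite_subset[OF sub is_graphD(1)[OF assms]] sub]
        card_mono[OF is_graphD(1)[OF assms] sub]
      by (simp add: m_def l_def h_def)
  qed
  from degree_power_sum_bound[where 'v = nat and k = h] obtain c0 :: real where c0: "c0 < 1"
    and star: "\<forall>G :: nat graph. is_graph G \<and> verts G \<noteq> {} \<and>
     c0 * (real (card (verts G)))\<^sup>2 \<le> 2 * real (card (edges G)) \<longrightarrow>
     (\<forall>r\<in>{1..h}. (\<Sum>v\<in>verts G. real (degree G v) ^ r) \<le> sqrt (2 * real (card (edges G))) ^ (r + 1))"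
    by (elim exE conjE)
  define c where "c = max 0 c0"
  have c: "0 \<le> c" "c < 1" "c0 \<le> c" using c0 by (auto simp: c_def)
  \<comment> \<open>Strictly between \<open>c\<close> and 1: the gap to \<open>c\<close> absorbs the
    difference between \<open>n * (n - 1)\<close> and \<open>n^2\<close> for large \<open>n\<close>,
    and \<open>c \<ge> 0\<close> makes it positive.\<close>
  define c' where "c' = (1 + c) / 2"
  have c': "0 < c'" "c' < 1" "c < c'" using c by (auto simp: c'_def)
  show ?thesis
  proof (intro exI[of _ c'] conjI allI impI c')
    fix \<epsilon> :: real assume \<epsilon>: "0 < \<epsilon>"
    obtain a0 where a0: "\<And>a. a0 \<le> a \<Longrightarrow> ((real a + 1) / (real a - real h)) ^ h \<le> 1 + \<epsilon>"
      using eventually_ratio_power_le[OF \<epsilon>, of h] by (auto simp: eventually_sequentially)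
    \<comment> \<open>Once the clique order \<open>a\<close> exceeds \<open>a1\<close>, the ratio
      bound applies and \<open>a > h\<close>. This threshold depends on \<open>\<epsilon>\<close>
      and \<open>H\<close> only, so the estimate is uniform in \<open>e\<close>.\<close>
    define a1 where "a1 = max a0 (h + 1)"
    have large: "\<forall>\<^sub>F n in sequentially. K \<le> real n" for K
      using filterlim_real_sequentially by (simp add: filterlim_at_top)
    have "\<forall>\<^sub>F n in sequentially. c * (real n)\<^sup>2 \<le> c' * (real n * (real n - 1))"
      using large[of "c' / (c' - c)"]
    proof eventually_elim
      case (elim n)
      then have "c' \<le> (c' - c) * real n" using c' by (simp add: divide_le_eq mult.commute)
      then have "c' * real n \<le> (c' - c) * real n * real n" by (rule mult_right_mono) simp
      then show ?case by (simp add: power2_eq_square algebra_simps)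
    qed
    moreover have "\<forall>\<^sub>F n in sequentially. (real a1 + 1)\<^sup>2 < c' * (real n * (real n - 1))"
      using large[of 2] large[of "((real a1 + 1)\<^sup>2 + 1) / c'"]
    proof eventually_elim
      case (elim n)
      have "(real a1 + 1)\<^sup>2 + 1 \<le> c' * (real n * 1)"
        using elim(2) c' by (simp add: divide_le_eq mult.commute)
      also have "\<dots> \<le> c' * (real n * (real n - 1))"
        using elim(1) c' by (intro mult_left_mono) auto
      finally show ?case by simp
    qed
    ultimately show "\<forall>\<^sub>F n in sequentially. \<forall>e::nat.
       c' * real (n choose 2) \<le> real e \<and> e \<le> n choose 2 \<longrightarrow>
       \<bar>real (ex_copies n e H) - real (num_copies H (quasi_clique n e))\<bar>
         \<le> \<epsilon> * real (num_copies H (quasi_clique n e))"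
      using eventually_gt_at_top[of 0]
    proof eventually_elim
      case (elim n)
      show ?case
      proof (intro allI impI)
        fix e assume "c' * real (n choose 2) \<le> real e \<and> e \<le> n choose 2"
        then have e: "c' * real (n choose 2) \<le> real e" "e \<le> n choose 2" by auto
        have "c' * (real n * (real n - 1)) \<le> 2 * real e"
          unfolding two_choose_two[symmetric] using e(1) by simp
        then have dense: "c * (real n)\<^sup>2 \<le> 2 * real e" "(real a1 + 1)\<^sup>2 < 2 * real e"
          using elim by linarith+
        obtain a b where ab: "e = (a choose 2) + b" "b < a"
          using quasi_clique_params_exist by blast
        \<comment> \<open>From \<open>b \<le> a - 1\<close>. The outcome
          \<open>sqrt (2 * real e) \<le> a + 1\<close> ties the upper bound to the clique
          order.\<close>
        have "2 * real e \<le> real a * (real a - 1) + 2 * (real a - 1)"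
          using ab two_choose_two[of a] by simp
        also have "\<dots> \<le> (real a + 1)\<^sup>2" by (simp add: power2_eq_square algebra_simps)
        finally have ea: "2 * real e \<le> (real a + 1)\<^sup>2" .
        then have "(real a1 + 1)\<^sup>2 < (real a + 1)\<^sup>2" using dense by linarith
        then have "real a1 + 1 < real a + 1" by (rule power2_less_imp_less) simp
        then have a: "a0 \<le> a" "h < a" by (auto simp: a1_def)
        have an: "a \<le> n"
        proof (rule ccontr)
          assume "\<not> a \<le> n"
          then have "Suc n choose 2 \<le> a choose 2" by (intro binomial_right_mono) auto
          then show False using ab(1) e(2) elim by (simp add: choose_two_Suc)
        qed
        define Q where "Q = quasi_clique n e"
        have Q: "is_graph Q" "card (verts Q) = n" "card (edges Q) = e"
          using quasi_clique_graph[OF e(2)] by (auto simp: Q_def)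
        \<comment> \<open>One factor serves both kinds of vertices: \<open>a \<le> n\<close> implies
          that \<open>n / (n - h)\<close> is at most this ratio as well.\<close>
        define \<rho> where "\<rho> = (real a + 1) / (real a - real h)"
        have \<rho>0: "0 \<le> \<rho>" using a by (simp add: \<rho>_def)
        have \<rho>a: "real a + 1 = \<rho> * real (a - h)" using a by (simp add: \<rho>_def of_nat_diff)
        have "real a * real h \<le> real n * real h" using an by (intro mult_right_mono) auto
        then have \<rho>n: "real n \<le> \<rho> * real (n - h)"
          using a an by (simp add: \<rho>_def of_nat_diff field_simps)
        have emb: "real (card (embeddings H G)) \<le> (1 + \<epsilon>) * real (card (embeddings H Q))"
          if G: "is_graph G" "card (verts G) = n" "card (edges G) = e" for G :: "nat graph"
        proof -
          have "c0 * (real n)\<^sup>2 \<le> c * (real n)\<^sup>2" using c by (intro mult_right_mono) auto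
          moreover have "verts G \<noteq> {}" using G(2) elim by auto
          ultimately have "\<forall>r\<in>{1..h}. (\<Sum>v\<in>verts G. real (degree G v) ^ r)
              \<le> sqrt (2 * real e) ^ (r + 1)"
            using star[rule_format, of G] G dense by auto
          then have "real (card (embeddings H G)) \<le> sqrt (2 * real e) ^ m * real n ^ l"
            using card_embeddings_le[OF assms is_graphD(1)[OF G(1)], of "sqrt (2 * real e)"] G(2)
            by (simp add: m_def l_def h_def)
          also have "\<dots> \<le> (\<rho> * real (a - h)) ^ m * (\<rho> * real (n - h)) ^ l"
          proof (intro mult_mono power_mono \<rho>n)
            show "sqrt (2 * real e) \<le> \<rho> * real (a - h)"
              unfolding \<rho>a[symmetric] using ea by (intro real_le_lsqrt) auto
          qed (use \<rho>0 in auto)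
          also have "\<dots> = \<rho> ^ h * real ((a - h) ^ m * (n - h) ^ l)"
            by (simp add: power_mult_distrib ml[symmetric] power_add)
          also have "\<dots> \<le> (1 + \<epsilon>) * real (card (embeddings H Q))"
          proof (intro mult_mono)
            show "\<rho> ^ h \<le> 1 + \<epsilon>" unfolding \<rho>_def by (rule a0[OF a(1)])
            show "real ((a - h) ^ m * (n - h) ^ l) \<le> real (card (embeddings H Q))"
              using card_embeddings_quasi_clique_ge[OF assms ab an]
              by (simp only: h_def m_def l_def Q_def of_nat_le_iff)
          qed (use \<epsilon> in auto)
          finally show ?thesis .
        qed
        have le: "real (num_copies H G) \<le> (1 + \<epsilon>) * real (num_copies H Q)"
          if G: "is_graph G" "card (verts G) = n" "card (edges G) = e" for G :: "nat graph"
        proof -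
          \<comment> \<open>The number of automorphisms is the same positive factor for
            \<open>G\<close> and \<open>Q\<close>, so it cancels.\<close>
          define K where "K = real (card {f \<in> embeddings H H. image_graph f H = H})"
          have "K * real (num_copies H G) \<le> K * ((1 + \<epsilon>) * real (num_copies H Q))"
            using emb[OF G] card_embeddings[OF assms is_graphD(1)[OF G(1)]]
              card_embeddings[OF assms is_graphD(1)[OF Q(1)]]
            by (simp add: K_def mult.left_commute)
          then show ?thesis
            using card_automorphisms_pos[OF assms] by (simp add: K_def)
        qed
        note att = ex_copies_attained[OF e(2), of H]
        have "ex_copies n e H \<in> {num_copies H G | G :: nat graph.
            is_graph G \<and> card (verts G) = n \<and> card (edges G) = e}"
          unfolding ex_copies_def by (rule Max_in[OF att])
        then have "real (ex_copies n e H) \<le> (1 + \<epsilon>) * real (num_copies H Q)"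
          using le by auto
        \<comment> \<open>The quasi-clique is itself one of the competing graphs.\<close>
        moreover have "num_copies H Q \<le> ex_copies n e H"
          unfolding ex_copies_def using Q by (intro Max_ge[OF att(1)]) blast
        ultimately show "\<bar>real (ex_copies n e H) - real (num_copies H (quasi_clique n e))\<bar>
            \<le> \<epsilon> * real (num_copies H (quasi_clique n e))"
          by (simp add: Q_def algebra_simps)
      qed
    qed
  qed
qed

end
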